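(* Let $0<\tau_1\le\dots\le\tau_q$, let $\hat J=-\hat J^\top\in\mathbb{R}^{n\times n}$, let $\hat R\in\mathbb{R}^{n\times n}$ be symmetric positive semi-definite, $\hat A:=\hat J-\hat R$, $\hat Z_1,\dots,\hat Z_q\in\mathbb{R}^{n\times n}$, $\hat B\in\mathbb{R}^{n\times m}$. Consider the port-Hamiltonian system with delay terms $$\dot x(t)=\hat A x(t)+\sum_{i=1}^q\hat Z_i x(t-\tau_i)+\hat B u(t),\quad t\ge 0,\qquad x(t)=\phi(t),\ t\in[-\tau_q,0],$$ with output of the form $$y(t)=Cx(t)+\sum_{i=1}^q C_i x(t-\tau_i)+\sum_{i=1}^q\hat C_i\int_{t-\tau_i}^{t} x(s)\,\mathrm{d}s,\qquad C,C_i,\hat C_i\in\mathbb{R}^{m\times n}$$ (the collocated output $y=\hat B^\top x$ is the case $C=\hat B^\top$, $C_i=\hat C_i=0$), and put $$\mathcal{C}:=\begin{bmatrix} C& C_1&\cdots& C_q&\tau_1\hat C_1&\cdots&\tau_q\hat C_q&0\end{bmatrix}\in\mathbb{R}^{m\times (n(2q+1)+m)}.$$ The system is passive for the delays $0<\tau_1\le\dots\le\tau_q$ with storage function $$\mathcal{S}(x_t)=\xi_q(t)^\top\mathcal{P}\xi_q(t)+\sum_{i=1}^q\int_{t-\tau_i}^t x(s)^\top\Theta_ix(s)\,\mathrm{d}s+\sum_{i=1}^q\tau_i\int_{t-\tau_i}^t\int_s^t x(v)^\top\Omega_ix(v)\,\mathrm{d}v\,\mathrm{d}s+\sum_{i=1}^q\tau_i\int_{t-\tau_i}^t\int_s^t\dot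 x(v)^\top\Gamma_i\dot x(v)\,\mathrm{d}v\,\mathrm{d}s,$$ where $\xi_q(t)=\begin{bmatrix}x(t)^\top&\int_{t-\tau_1}^t x(s)^\top\mathrm{d}s&\cdots&\int_{t-\tau_q}^t x(s)^\top\mathrm{d}s\end{bmatrix}^\top\in\mathbb{R}^{n(q+1)}$, if there exist positive semi-definite matrices $\mathcal{P}\in\mathbb{R}^{n(q+1)\times n(q+1)}$ and $\Theta_i,\Omega_i,\Gamma_i\in\mathbb{R}^{n\times n}$ ($i=1,\dots,q$) such that $$2\,\mathrm{sym}(G_2^\top\mathcal{P}G_1)+M_1+M_{2,\tau}+M_{3,\tau}+M_4+M_5\le 0 .$$ Here all matrices are partitioned column-wise (and the $M$'s also row-wise) into blocks of sizes $n,\ nq,\ nq,\ m$, and, with $\Gamma_{\Sigma,\tau}:=\sum_{i=1}^q\tau_i^2\Gamma_i$, $\Omega_{\Sigma,\tau}:=\sum_{i=1}^q\tau_i^2\Omega_i$, $\Gamma_{\Sigma,1}:=\sum_{i=1}^q\Gamma_i$, $\hat Z:=\begin{bmatrix}\hat Z_1&\cdots&\hat Z_q\end{bmatrix}$, $\Gamma_{\rm row}:=\begin{bmatrix}\Gamma_1&\cdots&\Gamma_q\end{bmatrix}$, $$G_1=\begin{bmatrix} I_n&0&0&0\\0&0&\mathrm{diag}(\tau_iI_n)_{i=1}^q&0\end{bmatrix},\qquad G_2=\begin{bmatrix}\hat A&\hat Z&0&\hat B\\ \begin{bmatrix}I_n&\cdots&I_n\end{bmatrix}^\top&-I_{nq}&0&0\end{bmatrix},$$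 $$M_1=\begin{bmatrix}\sum_{i=1}^q\Theta_i&0&0&0\\0&-\mathrm{diag}(\Theta_i)_{i=1}^q&0&0\\0&0&0&0\\0&0&0&0\end{bmatrix},$$ $$M_{2,\tau}=\begin{bmatrix}\hat A^\top\Gamma_{\Sigma,\tau}\hat A&\hat A^\top\Gamma_{\Sigma,\tau}\hat Z&0&\hat A^\top\Gamma_{\Sigma,\tau}\hat B\\ *&\hat Z^\top\Gamma_{\Sigma,\tau}\hat Z&0&\hat Z^\top\Gamma_{\Sigma,\tau}\hat B\\0&0&-\mathrm{diag}(\tau_i^2\Omega_i)_{i=1}^q&0\\ *&*&0&\hat B^\top\Gamma_{\Sigma,\tau}\hat B\end{bmatrix},$$ $$M_{3,\tau}=\begin{bmatrix}-\Gamma_{\Sigma,1}+\Omega_{\Sigma,\tau}&\Gamma_{\rm row}&0&0\\ *&-\mathrm{diag}(\Gamma_i)_{i=1}^q&0&0\\0&0&0&0\\0&0&0&0\end{bmatrix},$$ $$M_4=-3\begin{bmatrix}\Gamma_{\Sigma,1}&\Gamma_{\rm row}&-2\Gamma_{\rm row}&0\\ *&\mathrm{diag}(\Gamma_i)_{i=1}^q&-2\,\mathrm{diag}(\Gamma_i)_{i=1}^q&0\\ *&*&4\,\mathrm{diag}(\Gamma_i)_{i=1}^q&0\\0&0&0&0\end{bmatrix},$$ $$M_5=-\mathrm{sym}\left(\begin{bmatrix}0&\cdots&0&I_m\end{bmatrix}^\top\mathcal{C}\right).$$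
   Context: Notation: $\mathrm{sym}(A)=\tfrac12(A+A^\top)$; $\mathrm{diag}(A_i)_{i=1}^q$ is the block-diagonal matrix with diagonal blocks $A_1,\dots,A_q$; $*$ in a symmetric block matrix denotes the transpose of the corresponding block above the diagonal; positive semi-definite matrices are symmetric, and $M\le 0$ means that $-M$ is positive semi-definite. For $t\ge0$, $x_t:[-\tau_q,0]\to\mathbb{R}^n$ is $x_t(s)=x(t+s)$. Passivity: the delay system with input $u$ and output $y$ is called passive for fixed delays $0<\tau_1\le\dots\le\tau_q$ if there exists a storage function $\mathcal{S}:C^1([-\tau_q,0],\mathbb{R}^n)\to[0,\infty)$ with $\mathcal{S}(0)=0$ such that for all $0\le t_0\le t_1<\infty$ and all initial histories $\phi\in C^1([-\tau_q,0],\mathbb{R}^n)$ $$\mathcal{S}(x_{t_1})-\mathcal{S}(x_{t_0})\le\int_{t_0}^{t_1}y(s)^\top u(s)\,\mathrm{d}s ,$$ where $x$ is the solution of the system with history $\phi$ (and input $u$). *)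

theory Defs
  imports "HOL-Analysis.Analysis"
begin

text \<open>
  The index set of the delays is a type \<open>'q::{finite,linorder}\<close>; its order is the order
  \<open>1 < \<dots> < q\<close>. Block matrices are indexed by sum and product types: \<open>'q \<times> 'n\<close> is the index
  set of \<open>\<real>\<^sup>n\<^sup>q\<close> (delay first, component second), \<open>'n + 'q \<times> 'n\<close> that of \<open>\<real>\<^sup>n\<^sup>(\<^sup>q\<^sup>+\<^sup>1\<^sup>)\<close>, and
  \<open>'n + 'q \<times> 'n + 'q \<times> 'n + 'm\<close> (associated to the right) that of \<open>\<real>\<^sup>n\<^sup>(\<^sup>2\<^sup>q\<^sup>+\<^sup>1\<^sup>)\<^sup>+\<^sup>m\<close>.
\<close>

subsection \<open>Matrices\<close>

definition pos_semidef :: "real ^ 'a ^ 'a \<Rightarrow> bool" where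
  "pos_semidef M \<longleftrightarrow> transpose M = M \<and> (\<forall>v. 0 \<le> v \<bullet> (M *v v))"

definition neg_semidef :: "real ^ 'a ^ 'a \<Rightarrow> bool" where
  "neg_semidef M \<longleftrightarrow> pos_semidef (- M)"

definition sym_part :: "real ^ 'a ^ 'a \<Rightarrow> real ^ 'a ^ 'a" where
  "sym_part A = (1/2) *\<^sub>R (A + transpose A)"

definition hcat :: "real ^ 'a ^ 'r \<Rightarrow> real ^ 'b ^ 'r \<Rightarrow> real ^ ('a + 'b) ^ 'r" where
  "hcat A B = (\<chi> i j. case j of Inl a \<Rightarrow> A $ i $ a | Inr b \<Rightarrow> B $ i $ b)"

definition vcat :: "real ^ 'c ^ 'a \<Rightarrow> real ^ 'c ^ 'b \<Rightarrow> real ^ 'c ^ ('a + 'b)" where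
  "vcat A B = (\<chi> i. case i of Inl a \<Rightarrow> A $ a | Inr b \<Rightarrow> B $ b)"

definition row4 :: "real ^ 'a ^ 'r \<Rightarrow> real ^ 'b ^ 'r \<Rightarrow> real ^ 'c ^ 'r \<Rightarrow> real ^ 'd ^ 'r
    \<Rightarrow> real ^ ('a + 'b + 'c + 'd) ^ 'r" where
  "row4 A B C D = hcat A (hcat B (hcat C D))"

definition col4 :: "real ^ 'k ^ 'a \<Rightarrow> real ^ 'k ^ 'b \<Rightarrow> real ^ 'k ^ 'c \<Rightarrow> real ^ 'k ^ 'd
    \<Rightarrow> real ^ 'k ^ ('a + 'b + 'c + 'd)" where
  "col4 A B C D = vcat A (vcat B (vcat C D))"

text \<open>\<open>[A\<^sub>1 \<dots> A\<^sub>q]\<close>, its vertical analogue, and \<open>diag(A\<^sub>i)\<close>.\<close>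

definition brow :: "('q::finite \<Rightarrow> real ^ 'a ^ 'r) \<Rightarrow> real ^ ('q \<times> 'a) ^ 'r" where
  "brow A = (\<chi> i j. A (fst j) $ i $ snd j)"

definition bcol :: "('q::finite \<Rightarrow> real ^ 'c ^ 'a) \<Rightarrow> real ^ 'c ^ ('q \<times> 'a)" where
  "bcol A = (\<chi> i. A (fst i) $ snd i)"

definition bdiag :: "('q::finite \<Rightarrow> real ^ 'a ^ 'a) \<Rightarrow> real ^ ('q \<times> 'a) ^ ('q \<times> 'a)" where
  "bdiag A = (\<chi> i j. if fst i = fst j then A (fst i) $ snd i $ snd j else 0)"

subsection \<open>The delay system\<close>

definition max_delay :: "('q::{finite,linorder} \<Rightarrow> real) \<Rightarrow> real" where
  "max_delay \<tau> = \<tau> (Max UNIV)"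

definition delay_solution ::
  "('q::{finite,linorder} \<Rightarrow> real) \<Rightarrow> real ^ 'n ^ 'n \<Rightarrow> ('q \<Rightarrow> real ^ 'n ^ 'n) \<Rightarrow> real ^ 'm ^ 'n
    \<Rightarrow> (real \<Rightarrow> real ^ 'm) \<Rightarrow> (real \<Rightarrow> real ^ 'n) \<Rightarrow> (real \<Rightarrow> real ^ 'n) \<Rightarrow> bool" where
  "delay_solution \<tau> A Z B u \<phi> x \<longleftrightarrow>
     (\<forall>t\<in>{- max_delay \<tau>..0}. x t = \<phi> t) \<and>
     (\<forall>t\<ge>0. (x has_vector_derivative
        (A *v x t + (\<Sum>i\<in>UNIV. Z i *v x (t - \<tau> i)) + B *v u t)) (at t within {0..}))"

definition delay_output ::
  "('q::{finite,linorder} \<Rightarrow> real) \<Rightarrow> real ^ 'n ^ 'm \<Rightarrow> ('q \<Rightarrow> real ^ 'n ^ 'm)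
    \<Rightarrow> ('q \<Rightarrow> real ^ 'n ^ 'm) \<Rightarrow> (real \<Rightarrow> real ^ 'n) \<Rightarrow> real \<Rightarrow> real ^ 'm" where
  "delay_output \<tau> C Cd Ch x t =
     C *v x t + (\<Sum>i\<in>UNIV. Cd i *v x (t - \<tau> i))
     + (\<Sum>i\<in>UNIV. Ch i *v integral {t - \<tau> i..t} x)"

subsection \<open>Passivity\<close>

definition C1_on :: "real set \<Rightarrow> (real \<Rightarrow> 'a::real_normed_vector) \<Rightarrow> bool" where
  "C1_on I f \<longleftrightarrow> (\<exists>f'. continuous_on I f' \<and>
     (\<forall>s\<in>I. (f has_vector_derivative f' s) (at s within I)))"

text \<open>
  Functions on \<open>[-r,0]\<close> are represented by extensional functions, so that a functional of a
  history cannot depend on values outside the interval.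
\<close>

definition histories :: "real \<Rightarrow> (real \<Rightarrow> 'a::real_normed_vector) set" where
  "histories r = {\<phi> \<in> extensional {-r..0}. C1_on {-r..0} \<phi>}"

definition segment :: "real \<Rightarrow> (real \<Rightarrow> 'a) \<Rightarrow> real \<Rightarrow> (real \<Rightarrow> 'a)" where
  "segment r x t = (\<lambda>s\<in>{-r..0}. x (t + s))"

text \<open>
  If the derivative of the history at \<open>0\<close> does not match the right-hand side of the
  differential equation, the solution has a kink at time \<open>0\<close> and its segments are only
  piecewise \<open>C\<^sup>1\<close>. Storage functions are therefore defined on the following superset
  of \<^term>\<open>histories r\<close> (take \<open>c = 0\<close>), which contains all segments of all solutions.
\<close>

definition states :: "real \<Rightarrow> (real \<Rightarrow> 'a::real_normed_vector) set" where
  "states r = {\<psi> \<in> extensional {-r..0}. \<exists>c\<in>{-r..0}. C1_on {-r..c} \<psi> \<and> C1_on {c..0} \<psi>}"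

text \<open>
  \<open>sol u \<phi> x\<close>: \<open>x\<close> is a solution for input \<open>u\<close> and history \<open>\<phi>\<close>;
  \<open>out x\<close>: the output along \<open>x\<close>.
\<close>

definition storage_function ::
  "real \<Rightarrow> ((real \<Rightarrow> real ^ 'm) \<Rightarrow> (real \<Rightarrow> real ^ 'n) \<Rightarrow> (real \<Rightarrow> real ^ 'n) \<Rightarrow> bool)
    \<Rightarrow> ((real \<Rightarrow> real ^ 'n) \<Rightarrow> real \<Rightarrow> real ^ 'm) \<Rightarrow> ((real \<Rightarrow> real ^ 'n) \<Rightarrow> real) \<Rightarrow> bool" where
  "storage_function r sol out S \<longleftrightarrow>
     (\<forall>\<psi>\<in>states r. 0 \<le> S \<psi>) \<and> S (\<lambda>s\<in>{-r..0}. 0) = 0 \<and>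
     (\<forall>\<phi>\<in>histories r. \<forall>u x. continuous_on {0..} u \<longrightarrow> sol u \<phi> x \<longrightarrow>
       (\<forall>t0 t1. 0 \<le> t0 \<longrightarrow> t0 \<le> t1 \<longrightarrow>
         S (segment r x t1) - S (segment r x t0) \<le> integral {t0..t1} (\<lambda>s. out x s \<bullet> u s)))"

definition passive_system ::
  "real \<Rightarrow> ((real \<Rightarrow> real ^ 'm) \<Rightarrow> (real \<Rightarrow> real ^ 'n) \<Rightarrow> (real \<Rightarrow> real ^ 'n) \<Rightarrow> bool)
    \<Rightarrow> ((real \<Rightarrow> real ^ 'n) \<Rightarrow> real \<Rightarrow> real ^ 'm) \<Rightarrow> bool" where
  "passive_system r sol out \<longleftrightarrow> (\<exists>S. storage_function r sol out S)"

subsection \<open>The storage functional\<close>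

definition \<xi> :: "('q::{finite,linorder} \<Rightarrow> real) \<Rightarrow> (real \<Rightarrow> real ^ 'n) \<Rightarrow> real ^ ('n + 'q \<times> 'n)" where
  "\<xi> \<tau> \<psi> = (\<chi> j. case j of Inl a \<Rightarrow> \<psi> 0 $ a | Inr (i, a) \<Rightarrow> integral {- \<tau> i..0} \<psi> $ a)"

text \<open>
  \<open>\<S>(\<psi>)\<close> for \<open>\<psi> = x\<^sub>t\<close>, i.e. the integrals over \<open>[t - \<tau>\<^sub>i, t]\<close> are shifted by \<open>t\<close>. The one-sided
  derivative at the end points is the appropriate one; at a kink the value of
  \<^const>\<open>vector_derivative\<close> is arbitrary, which does not affect the integral.
\<close>

definition storage ::
  "('q::{finite,linorder} \<Rightarrow> real) \<Rightarrow> real ^ ('n + 'q \<times> 'n) ^ ('n + 'q \<times> 'n)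
    \<Rightarrow> ('q \<Rightarrow> real ^ 'n ^ 'n) \<Rightarrow> ('q \<Rightarrow> real ^ 'n ^ 'n) \<Rightarrow> ('q \<Rightarrow> real ^ 'n ^ 'n)
    \<Rightarrow> (real \<Rightarrow> real ^ 'n) \<Rightarrow> real" where
  "storage \<tau> P \<Theta> \<Omega> \<Gamma> \<psi> =
    (let D = (\<lambda>v. vector_derivative \<psi> (at v within {- max_delay \<tau>..0})) in
      \<xi> \<tau> \<psi> \<bullet> (P *v \<xi> \<tau> \<psi>)
      + (\<Sum>i\<in>UNIV. integral {- \<tau> i..0} (\<lambda>s. \<psi> s \<bullet> (\<Theta> i *v \<psi> s)))
      + (\<Sum>i\<in>UNIV. \<tau> i * integral {- \<tau> i..0} (\<lambda>s. integral {s..0} (\<lambda>v. \<psi> v \<bullet> (\<Omega> i *v \<psi> v))))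
      + (\<Sum>i\<in>UNIV. \<tau> i * integral {- \<tau> i..0} (\<lambda>s. integral {s..0} (\<lambda>v. D v \<bullet> (\<Gamma> i *v D v)))))"

subsection \<open>The matrices of the linear matrix inequality\<close>

definition G1 :: "('q::{finite,linorder} \<Rightarrow> real)
    \<Rightarrow> real ^ ('n::finite + 'q \<times> 'n + 'q \<times> 'n + 'm::finite) ^ ('n + 'q \<times> 'n)" where
  "G1 \<tau> = vcat (row4 (mat 1) 0 0 0)
               (row4 0 0 (bdiag (\<lambda>i. \<tau> i *\<^sub>R mat 1)) 0)"

definition G2 :: "real ^ 'n ^ 'n \<Rightarrow> ('q::{finite,linorder} \<Rightarrow> real ^ 'n ^ 'n) \<Rightarrow> real ^ 'm ^ 'n
    \<Rightarrow> real ^ ('n::finite + 'q \<times> 'n + 'q \<times> 'n + 'm::finite) ^ ('n + 'q \<times> 'n)" where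
  "G2 A Z B = vcat (row4 A (brow Z) 0 B)
                   (row4 (bcol (\<lambda>_. mat 1)) (- mat 1) 0 0)"

definition M1 :: "('q::{finite,linorder} \<Rightarrow> real ^ 'n ^ 'n)
    \<Rightarrow> real ^ ('n::finite + 'q \<times> 'n + 'q \<times> 'n + 'm::finite) ^ ('n + 'q \<times> 'n + 'q \<times> 'n + 'm)" where
  "M1 \<Theta> = col4
     (row4 (\<Sum>i\<in>UNIV. \<Theta> i) 0 0 0)
     (row4 0 (- bdiag \<Theta>) 0 0)
     (row4 0 0 0 0)
     (row4 0 0 0 0)"

definition M2 :: "('q::{finite,linorder} \<Rightarrow> real) \<Rightarrow> real ^ 'n ^ 'n \<Rightarrow> ('q \<Rightarrow> real ^ 'n ^ 'n)
    \<Rightarrow> real ^ 'm ^ 'n \<Rightarrow> ('q \<Rightarrow> real ^ 'n ^ 'n) \<Rightarrow> ('q \<Rightarrow> real ^ 'n ^ 'n)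
    \<Rightarrow> real ^ ('n::finite + 'q \<times> 'n + 'q \<times> 'n + 'm::finite) ^ ('n + 'q \<times> 'n + 'q \<times> 'n + 'm)" where
  "M2 \<tau> A Z B \<Omega> \<Gamma> =
    (let \<Gamma>s = (\<Sum>i\<in>UNIV. (\<tau> i)\<^sup>2 *\<^sub>R \<Gamma> i);
         Zr = brow Z;
         AZ = transpose A ** \<Gamma>s ** Zr;
         AB = transpose A ** \<Gamma>s ** B;
         ZB = transpose Zr ** \<Gamma>s ** B
     in col4
       (row4 (transpose A ** \<Gamma>s ** A) AZ 0 AB)
       (row4 (transpose AZ) (transpose Zr ** \<Gamma>s ** Zr) 0 ZB)
       (row4 0 0 (- bdiag (\<lambda>i. (\<tau> i)\<^sup>2 *\<^sub>R \<Omega> i)) 0)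
       (row4 (transpose AB) (transpose ZB) 0 (transpose B ** \<Gamma>s ** B)))"

definition M3 :: "('q::{finite,linorder} \<Rightarrow> real)
    \<Rightarrow> ('q \<Rightarrow> real ^ 'n ^ 'n) \<Rightarrow> ('q \<Rightarrow> real ^ 'n ^ 'n)
    \<Rightarrow> real ^ ('n::finite + 'q \<times> 'n + 'q \<times> 'n + 'm::finite) ^ ('n + 'q \<times> 'n + 'q \<times> 'n + 'm)" where
  "M3 \<tau> \<Omega> \<Gamma> = col4
     (row4 (- (\<Sum>i\<in>UNIV. \<Gamma> i) + (\<Sum>i\<in>UNIV. (\<tau> i)\<^sup>2 *\<^sub>R \<Omega> i)) (brow \<Gamma>) 0 0)
     (row4 (transpose (brow \<Gamma>)) (- bdiag \<Gamma>) 0 0)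
     (row4 0 0 0 0)
     (row4 0 0 0 0)"

definition M4 :: "('q::{finite,linorder} \<Rightarrow> real ^ 'n ^ 'n)
    \<Rightarrow> real ^ ('n::finite + 'q \<times> 'n + 'q \<times> 'n + 'm::finite) ^ ('n + 'q \<times> 'n + 'q \<times> 'n + 'm)" where
  "M4 \<Gamma> = (-3) *\<^sub>R col4
     (row4 (\<Sum>i\<in>UNIV. \<Gamma> i) (brow \<Gamma>) ((-2) *\<^sub>R brow \<Gamma>) 0)
     (row4 (transpose (brow \<Gamma>)) (bdiag \<Gamma>) ((-2) *\<^sub>R bdiag \<Gamma>) 0)
     (row4 (transpose ((-2) *\<^sub>R brow \<Gamma>)) (transpose ((-2) *\<^sub>R bdiag \<Gamma>)) (4 *\<^sub>R bdiag \<Gamma>) 0)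
     (row4 0 0 0 0)"

definition output_row :: "('q::{finite,linorder} \<Rightarrow> real) \<Rightarrow> real ^ 'n ^ 'm
    \<Rightarrow> ('q \<Rightarrow> real ^ 'n ^ 'm) \<Rightarrow> ('q \<Rightarrow> real ^ 'n ^ 'm)
    \<Rightarrow> real ^ ('n::finite + 'q \<times> 'n + 'q \<times> 'n + 'm::finite) ^ 'm" where
  "output_row \<tau> C Cd Ch = row4 C (brow Cd) (brow (\<lambda>i. \<tau> i *\<^sub>R Ch i)) 0"

definition M5 :: "('q::{finite,linorder} \<Rightarrow> real) \<Rightarrow> real ^ 'n ^ 'm
    \<Rightarrow> ('q \<Rightarrow> real ^ 'n ^ 'm) \<Rightarrow> ('q \<Rightarrow> real ^ 'n ^ 'm)
    \<Rightarrow> real ^ ('n::finite + 'q \<times> 'n + 'q \<times> 'n + 'm::finite) ^ ('n + 'q \<times> 'n + 'q \<times> 'n + 'm)" where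
  "M5 \<tau> C Cd Ch = - sym_part (transpose (row4 0 0 0 (mat 1)) ** output_row \<tau> C Cd Ch)"

end

theory Submission
  imports Defs
begin

text \<open>
  Along a solution, all four parts of the storage functional are differentiable for \<open>t \<ge> 0\<close>: a
  possible jump of \<open>x'\<close> at time \<open>0\<close> only enters under a double integral. In the derivative, the terms
  \<open>- \<tau>\<^sub>i \<integral> x\<^sup>T \<Omega>\<^sub>i x\<close> are bounded by Jensen's inequality and the terms \<open>- \<tau>\<^sub>i \<integral> x'\<^sup>T \<Gamma>\<^sub>i x'\<close> by the
  Wirtinger-based integral inequality. This upper bound, minus \<open>y\<^sup>T u\<close>, is the quadratic form of the linear
  matrix inequality at the vector \<open>\<zeta>\<close> composed of \<open>x(t)\<close>, the delayed states \<open>x(t - \<tau>\<^sub>i)\<close>, the means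
  of \<open>x\<close> over \<open>[t - \<tau>\<^sub>i, t]\<close>, and \<open>u(t)\<close>. Integrating over \<open>[t\<^sub>0, t\<^sub>1]\<close> gives the dissipation inequality.
\<close>

subsection \<open>Block matrices and their quadratic forms\<close>

text \<open>The vector counterpart of \<open>vcat\<close>, as \<open>stack\<close> is that of
  \<open>bcol\<close>. Vectors in this form let block matrices act on them by rewriting.\<close>

definition vjoin :: "real ^ 'a \<Rightarrow> real ^ 'b \<Rightarrow> real ^ ('a + 'b)" where
  "vjoin v w = (\<chi> i. case i of Inl a \<Rightarrow> v $ a | Inr b \<Rightarrow> w $ b)"

definition stack :: "('q::finite \<Rightarrow> real ^ 'a) \<Rightarrow> real ^ ('q \<times> 'a)" where
  "stack X = (\<chi> p. X (fst p) $ snd p)"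

lemma sum_UNIV_sum_type:
  "(\<Sum>i\<in>UNIV. f i) = (\<Sum>a\<in>UNIV. f (Inl a)) + (\<Sum>b\<in>UNIV. f (Inr b))"
  for f :: "'a::finite + 'b::finite \<Rightarrow> real"
  by (simp add: UNIV_Plus_UNIV [symmetric] sum.Plus del: UNIV_Plus_UNIV)

lemma sum_UNIV_prod_type:
  "(\<Sum>p\<in>UNIV. f p) = (\<Sum>a\<in>UNIV. \<Sum>b\<in>UNIV. f (a, b))"
  for f :: "'a::finite \<times> 'b::finite \<Rightarrow> 'c::comm_monoid_add"
  by (simp add: UNIV_Times_UNIV [symmetric] sum.cartesian_product del: UNIV_Times_UNIV)

lemma inner_vjoin: "vjoin v w \<bullet> vjoin v' w' = v \<bullet> v' + w \<bullet> w'"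
  by (simp add: inner_vec_def sum_UNIV_sum_type vjoin_def)

lemma inner_stack: "stack X \<bullet> stack Y = (\<Sum>i\<in>UNIV. X i \<bullet> Y i)"
  by (simp add: inner_vec_def sum_UNIV_prod_type stack_def)

lemma stack_diff: "stack X - stack Y = stack (\<lambda>i. X i - Y i)"
  by (simp add: stack_def vec_eq_iff)

lemma hcat_mult: "hcat A B *v vjoin v w = A *v v + B *v w"
  by (simp add: hcat_def vjoin_def matrix_vector_mult_def vec_eq_iff sum_UNIV_sum_type)

lemma vcat_mult: "vcat A B *v v = vjoin (A *v v) (B *v v)"
  by (simp add: vcat_def vjoin_def matrix_vector_mult_def vec_eq_iff split: sum.split)

lemma row4_mult:
  "row4 A B C D *v vjoin a (vjoin b (vjoin c d)) = A *v a + B *v b + C *v c + D *v d"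
  by (simp add: row4_def hcat_mult)

lemma col4_mult:
  "col4 A B C D *v v = vjoin (A *v v) (vjoin (B *v v) (vjoin (C *v v) (D *v v)))"
  by (simp add: col4_def vcat_mult)

lemma brow_mult: "brow Z *v stack X = (\<Sum>i\<in>UNIV. Z i *v X i)"
  by (simp add: brow_def stack_def matrix_vector_mult_def vec_eq_iff sum_UNIV_prod_type)

lemma bcol_mult: "bcol A *v v = stack (\<lambda>i. A i *v v)"
  by (simp add: bcol_def stack_def matrix_vector_mult_def vec_eq_iff)

lemma bdiag_mult: "bdiag A *v stack X = stack (\<lambda>i. A i *v X i)"
proof -
  have "(bdiag A *v stack X) $ (i, a) = stack (\<lambda>i. A i *v X i) $ (i, a)" for i a
  proof -
    have "(bdiag A *v stack X) $ (i, a)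
        = (\<Sum>j\<in>UNIV. \<Sum>b\<in>UNIV. (if i = j then A i $ a $ b else 0) * X j $ b)"
      by (simp only: bdiag_def stack_def matrix_vector_mult_def vec_lambda_beta
          sum_UNIV_prod_type fst_conv snd_conv)
    also have "\<dots> = (\<Sum>j\<in>UNIV. if i = j then \<Sum>b\<in>UNIV. A i $ a $ b * X j $ b else 0)"
      by (intro sum.cong) simp_all
    also have "\<dots> = stack (\<lambda>i. A i *v X i) $ (i, a)"
      by (simp add: stack_def matrix_vector_mult_def)
    finally show ?thesis .
  qed
  then show ?thesis
    by (simp add: vec_eq_iff split_paired_all)
qed

lemma brow_transpose_mult: "v v* brow Z = stack (\<lambda>i. v v* Z i)"
  by (simp add: brow_def stack_def vector_matrix_mult_def vec_eq_iff)

lemma uminus_matrix_vector_mult: "(- A) *v x = - (A *v x)" for A :: "real ^ 'n ^ 'm"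
  by (simp add: matrix_vector_mult_def vec_eq_iff sum_negf)

lemma scaleR_matrix_vector_mult: "(c *\<^sub>R A) *v x = c *\<^sub>R (A *v x)" for A :: "real ^ 'n ^ 'm"
  by (simp add: matrix_vector_mult_def vec_eq_iff sum_distrib_left mult.assoc)

lemma neg_semidefD: "neg_semidef M \<Longrightarrow> v \<bullet> (M *v v) \<le> 0"
  by (simp add: neg_semidef_def pos_semidef_def uminus_matrix_vector_mult)

lemma sum_matrix_vector_mult: "(\<Sum>i\<in>I. A i) *v x = (\<Sum>i\<in>I. A i *v x)"
  for A :: "'i \<Rightarrow> real ^ 'n ^ 'm"
  by (induction I rule: infinite_finite_induct) (auto simp: algebra_simps)

lemma inner_transpose_mult: "v \<bullet> (w v* M) = w \<bullet> (M *v v)" for M :: "real ^ 'k ^ 'l"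
  using dot_lmul_matrix [of w M v] by (simp add: inner_commute)

lemma inner_symmetric_matrix:
  fixes M :: "real ^ 'n ^ 'n"
  assumes "transpose M = M"
  shows "v \<bullet> (M *v w) = w \<bullet> (M *v v)"
  using inner_transpose_mult [of v w M] by (simp add: assms flip: transpose_matrix_vector)

text \<open>A matrix and its transpose have the same quadratic form. Hence symmetrization in the
  matrix inequality disappears, both around \<open>P\<close> and in \<open>M5\<close>.\<close>

lemma quadratic_sym_part: "v \<bullet> (sym_part A *v v) = v \<bullet> (A *v v)"
  by (simp add: sym_part_def scaleR_matrix_vector_mult matrix_vector_mult_add_rdistrib
      inner_add_right inner_transpose_mult)

lemma quadratic_transpose_mult: "v \<bullet> ((transpose A ** B) *v v) = (A *v v) \<bullet> (B *v v)"
  for A :: "real ^ 'n ^ 'k"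
  by (simp add: inner_transpose_mult inner_commute [of _ "B *v v"] flip: matrix_vector_mul_assoc)

section \<open>Quadratic forms of the summands of the matrix inequality\<close>

context
  fixes \<tau> :: "'q::{finite,linorder} \<Rightarrow> real"
    and x :: "real ^ 'n" and X Y :: "'q \<Rightarrow> real ^ 'n" and u :: "real ^ 'm"
    and \<zeta> :: "real ^ ('n + 'q \<times> 'n + 'q \<times> 'n + 'm)"
  defines "\<zeta> \<equiv> vjoin x (vjoin (stack X) (vjoin (stack Y) u))"
begin

text \<open>If \<open>Y i\<close> is the mean of the trajectory over the window of length
  \<open>\<tau> i\<close>, then \<open>\<tau> i *\<^sub>R Y i\<close> is its integral, so
  \<open>G1\<close> produces the vector \<xi> of the storage functional.\<close>

lemma G1_mult: "G1 \<tau> *v \<zeta> = vjoin x (stack (\<lambda>i. \<tau> i *\<^sub>R Y i))"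
  by (simp add: G1_def vcat_mult row4_mult \<zeta>_def bdiag_mult scaleR_matrix_vector_mult)

text \<open>If \<open>X i\<close> is the delayed state, the first block is the right-hand side of
  the delay equation and the others are the derivatives of the window integrals: \<open>G2\<close>
  produces the time derivative of \<xi>.\<close>

lemma G2_mult:
  "G2 A Z B *v \<zeta> = vjoin (A *v x + (\<Sum>i\<in>UNIV. Z i *v X i) + B *v u) (stack (\<lambda>i. x - X i))"
  by (simp add: G2_def vcat_mult row4_mult \<zeta>_def brow_mult bcol_mult uminus_matrix_vector_mult
      stack_diff)

text \<open>These are the boundary terms in the derivative of the single integrals weighted by
  \<Theta>.\<close>

lemma quadratic_M1:
  "\<zeta> \<bullet> (M1 \<Theta> *v \<zeta>) = (\<Sum>i\<in>UNIV. x \<bullet> (\<Theta> i *v x) - X i \<bullet> (\<Theta> i *v X i))"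
  by (simp add: M1_def col4_mult row4_mult \<zeta>_def inner_vjoin bdiag_mult inner_stack
      uminus_matrix_vector_mult sum_matrix_vector_mult inner_sum_right sum_subtractf)

text \<open>The blocks containing \<open>A\<close>, \<open>Z\<close> and \<open>B\<close> form the
  product F^T S F with F = [A Z 0 B] and S the weighted sum of the \<open>\<Gamma> i\<close>, and F
  maps \<open>\<zeta>\<close> to \<open>f\<close>. The third diagonal block gives the Jensen term in
  \<open>Y\<close>.\<close>

lemma quadratic_M2:
  fixes A :: "real ^ 'n ^ 'n" and Z :: "'q \<Rightarrow> real ^ 'n ^ 'n" and B :: "real ^ 'm ^ 'n"
  assumes "\<And>i. transpose (\<Gamma> i) = \<Gamma> i"
  defines "f \<equiv> A *v x + (\<Sum>i\<in>UNIV. Z i *v X i) + B *v u"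
  shows "\<zeta> \<bullet> (M2 \<tau> A Z B \<Omega> \<Gamma> *v \<zeta>)
       = (\<Sum>i\<in>UNIV. (\<tau> i)\<^sup>2 * (f \<bullet> (\<Gamma> i *v f)) - (\<tau> i)\<^sup>2 * (Y i \<bullet> (\<Omega> i *v Y i)))"
proof -
  define \<Gamma>s where "\<Gamma>s = (\<Sum>i\<in>UNIV. (\<tau> i)\<^sup>2 *\<^sub>R \<Gamma> i)"
  have \<Gamma>s: "v \<bullet> (\<Gamma>s *v w) = (\<Sum>i\<in>UNIV. (\<tau> i)\<^sup>2 * (v \<bullet> (\<Gamma> i *v w)))" for v w
    by (simp add: \<Gamma>s_def sum_matrix_vector_mult scaleR_matrix_vector_mult inner_sum_right)
  \<comment> \<open>The starred blocks are transposes; symmetry brings all cross terms into one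
    fixed order, so that they match those of the expanded form in \<open>f\<close>.\<close>
  have sym: "v \<bullet> (\<Gamma>s *v w) = w \<bullet> (\<Gamma>s *v v)" for v w
    unfolding \<Gamma>s using inner_symmetric_matrix [OF assms(1)] by (metis (no_types, lifting))
  define s where "s = (\<Sum>i\<in>UNIV. Z i *v X i)"
  have "\<zeta> \<bullet> (M2 \<tau> A Z B \<Omega> \<Gamma> *v \<zeta>)
      = f \<bullet> (\<Gamma>s *v f) - (\<Sum>i\<in>UNIV. (\<tau> i)\<^sup>2 * (Y i \<bullet> (\<Omega> i *v Y i)))"
    unfolding M2_def Let_def \<Gamma>s_def [symmetric] \<zeta>_def col4_mult row4_mult inner_vjoin
      inner_add_right transpose_matrix_vector inner_transpose_mult
      matrix_vector_mul_assoc [symmetric] brow_mult f_def s_def [symmetric]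
      uminus_matrix_vector_mult bdiag_mult inner_minus_right inner_stack
      matrix_vector_right_distrib inner_add_left scaleR_matrix_vector_mult
      sym [of "B *v u" "A *v x"] sym [of "B *v u" s] sym [of s "A *v x"]
    by (simp add: inner_commute)
  then show ?thesis
    by (simp add: \<Gamma>s sum_subtractf)
qed

text \<open>The \<Omega> part is the boundary term from differentiating the double integral of the
  state. The \<Gamma> part completes to a square in \<open>x - X i\<close>, the integral of the
  derivative over the window: the first Wirtinger term.\<close>

lemma quadratic_M3:
  assumes sym: "\<And>i. transpose (\<Gamma> i) = \<Gamma> i"
  shows "\<zeta> \<bullet> (M3 \<tau> \<Omega> \<Gamma> *v \<zeta>)
       = (\<Sum>i\<in>UNIV. (\<tau> i)\<^sup>2 * (x \<bullet> (\<Omega> i *v x)) - (x - X i) \<bullet> (\<Gamma> i *v (x - X i)))"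
proof -
  have [simp]: "v v* \<Gamma> i = \<Gamma> i *v v" for i v
    by (metis sym transpose_matrix_vector)
  have "\<zeta> \<bullet> (M3 \<tau> \<Omega> \<Gamma> *v \<zeta>) = (\<Sum>i\<in>UNIV. (\<tau> i)\<^sup>2 * (x \<bullet> (\<Omega> i *v x)))
      - (\<Sum>i\<in>UNIV. x \<bullet> (\<Gamma> i *v x)) + (\<Sum>i\<in>UNIV. x \<bullet> (\<Gamma> i *v X i))
      + (\<Sum>i\<in>UNIV. X i \<bullet> (\<Gamma> i *v x)) - (\<Sum>i\<in>UNIV. X i \<bullet> (\<Gamma> i *v X i))"
    by (simp add: M3_def col4_mult row4_mult \<zeta>_def inner_vjoin bdiag_mult brow_mult
        brow_transpose_mult inner_stack uminus_matrix_vector_mult sum_matrix_vector_mult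
        scaleR_matrix_vector_mult inner_sum_right matrix_vector_mult_add_rdistrib
        matrix_vector_mult_diff_rdistrib inner_add_right inner_diff_right)
  moreover have "(x - X i) \<bullet> (\<Gamma> i *v (x - X i)) = x \<bullet> (\<Gamma> i *v x) - x \<bullet> (\<Gamma> i *v X i)
      - X i \<bullet> (\<Gamma> i *v x) + X i \<bullet> (\<Gamma> i *v X i)" for i
    by (simp add: matrix_vector_mult_diff_distrib inner_diff_left inner_diff_right)
  ultimately show ?thesis
    by (simp add: sum.distrib sum_subtractf)
qed

text \<open>The blocks are those of a square in \<open>x + X i - 2 *\<^sub>R Y i\<close>, which is,
  up to scaling, the first moment of the derivative over the window: the second Wirtinger
  term.\<close>

lemma quadratic_M4:
  assumes sym: "\<And>i. transpose (\<Gamma> i) = \<Gamma> i"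
  shows "\<zeta> \<bullet> (M4 \<Gamma> *v \<zeta>)
       = - 3 * (\<Sum>i\<in>UNIV. (x + X i - 2 *\<^sub>R Y i) \<bullet> (\<Gamma> i *v (x + X i - 2 *\<^sub>R Y i)))"
proof -
  have vm: "v v* \<Gamma> i = \<Gamma> i *v v" for i v
    by (metis sym transpose_matrix_vector)
  have "\<Gamma> i $ a $ b = \<Gamma> i $ b $ a" for i a b
    using arg_cong [OF sym [of i], of "\<lambda>M. M $ b $ a"] by (simp add: transpose_def)
  then have "transpose (bdiag \<Gamma>) = bdiag \<Gamma>"
    by (simp add: transpose_def bdiag_def vec_eq_iff)
  then have bd: "v v* bdiag \<Gamma> = bdiag \<Gamma> *v v" for v
    by (metis transpose_matrix_vector)
  have sc: "v v* ((-2) *\<^sub>R M) = (-2) *\<^sub>R (v v* M)" for v and M :: "real ^ 'k ^ 'l"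
    by (simp add: vector_matrix_mult_def vec_eq_iff sum_distrib_left sum_negf algebra_simps)
  have "\<zeta> \<bullet> (M4 \<Gamma> *v \<zeta>) = - 3 * ((\<Sum>i\<in>UNIV. x \<bullet> (\<Gamma> i *v x)) + (\<Sum>i\<in>UNIV. x \<bullet> (\<Gamma> i *v X i))
      - 2 * (\<Sum>i\<in>UNIV. x \<bullet> (\<Gamma> i *v Y i))
      + (\<Sum>i\<in>UNIV. X i \<bullet> (\<Gamma> i *v x)) + (\<Sum>i\<in>UNIV. X i \<bullet> (\<Gamma> i *v X i))
      - 2 * (\<Sum>i\<in>UNIV. X i \<bullet> (\<Gamma> i *v Y i))
      - 2 * (\<Sum>i\<in>UNIV. Y i \<bullet> (\<Gamma> i *v x)) - 2 * (\<Sum>i\<in>UNIV. Y i \<bullet> (\<Gamma> i *v X i))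
      + 4 * (\<Sum>i\<in>UNIV. Y i \<bullet> (\<Gamma> i *v Y i)))"
    unfolding M4_def scaleR_matrix_vector_mult col4_mult row4_mult \<zeta>_def inner_vjoin
      inner_scaleR_right transpose_matrix_vector sc bd vm bdiag_mult brow_mult brow_transpose_mult
      inner_add_right inner_stack sum_matrix_vector_mult inner_sum_right matrix_vector_mult_0
      inner_zero_right sum_distrib_left [symmetric]
    by algebra
  moreover have "(x + X i - 2 *\<^sub>R Y i) \<bullet> (\<Gamma> i *v (x + X i - 2 *\<^sub>R Y i))
      = x \<bullet> (\<Gamma> i *v x) + x \<bullet> (\<Gamma> i *v X i) - 2 * (x \<bullet> (\<Gamma> i *v Y i))
      + X i \<bullet> (\<Gamma> i *v x) + X i \<bullet> (\<Gamma> i *v X i) - 2 * (X i \<bullet> (\<Gamma> i *v Y i))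
      - 2 * (Y i \<bullet> (\<Gamma> i *v x)) - 2 * (Y i \<bullet> (\<Gamma> i *v X i)) + 4 * (Y i \<bullet> (\<Gamma> i *v Y i))" for i
    by (simp add: matrix_vector_mult_diff_distrib matrix_vector_right_distrib
        matrix_vector_mult_scaleR inner_add_left inner_add_right inner_diff_left
        inner_diff_right)
  ultimately show ?thesis
    by (simp add: sum.distrib sum_subtractf flip: sum_distrib_left)
qed

text \<open>This is the negative supply rate: for means \<open>Y i\<close>, the vector paired with
  \<open>u\<close> is the output.\<close>

lemma quadratic_M5:
  "\<zeta> \<bullet> (M5 \<tau> C Cd Ch *v \<zeta>)
     = - ((C *v x + (\<Sum>i\<in>UNIV. Cd i *v X i) + (\<Sum>i\<in>UNIV. \<tau> i *\<^sub>R (Ch i *v Y i))) \<bullet> u)"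
  by (simp add: M5_def uminus_matrix_vector_mult quadratic_sym_part quadratic_transpose_mult
      output_row_def row4_mult \<zeta>_def brow_mult scaleR_matrix_vector_mult inner_commute)

text \<open>The matrix inequality evaluated at \<open>\<zeta>\<close>, with the supply rate moved to
  the right. This is pointwise algebra in free vectors \<open>x\<close>, \<open>X\<close>,
  \<open>Y\<close>, \<open>u\<close>; the trajectory is substituted later.\<close>

lemma lmi_dissipation:
  assumes P: "pos_semidef P" and \<Gamma>: "\<And>i. pos_semidef (\<Gamma> i)"
    and lmi: "neg_semidef (2 *\<^sub>R sym_part (transpose (G2 A Z B) ** P ** G1 \<tau>)
           + M1 \<Theta> + M2 \<tau> A Z B \<Omega> \<Gamma> + M3 \<tau> \<Omega> \<Gamma> + M4 \<Gamma> + M5 \<tau> C Cd Ch)"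
  defines "f \<equiv> A *v x + (\<Sum>i\<in>UNIV. Z i *v X i) + B *v u"
    and "e \<equiv> \<lambda>i. x + X i - 2 *\<^sub>R Y i"
  shows "2 * (vjoin x (stack (\<lambda>i. \<tau> i *\<^sub>R Y i)) \<bullet> (P *v vjoin f (stack (\<lambda>i. x - X i))))
      + (\<Sum>i\<in>UNIV. x \<bullet> (\<Theta> i *v x) - X i \<bullet> (\<Theta> i *v X i))
      + (\<Sum>i\<in>UNIV. (\<tau> i)\<^sup>2 * (x \<bullet> (\<Omega> i *v x)) - (\<tau> i)\<^sup>2 * (Y i \<bullet> (\<Omega> i *v Y i)))
      + (\<Sum>i\<in>UNIV. (\<tau> i)\<^sup>2 * (f \<bullet> (\<Gamma> i *v f)) - (x - X i) \<bullet> (\<Gamma> i *v (x - X i))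
          - 3 * (e i \<bullet> (\<Gamma> i *v e i)))
    \<le> (C *v x + (\<Sum>i\<in>UNIV. Cd i *v X i) + (\<Sum>i\<in>UNIV. \<tau> i *\<^sub>R (Ch i *v Y i))) \<bullet> u"
proof -
  have sym: "transpose (\<Gamma> i) = \<Gamma> i" for i
    using \<Gamma> by (simp add: pos_semidef_def)
  have "transpose P = P"
    using P by (simp add: pos_semidef_def)
  \<comment> \<open>The product with \<open>G2\<close> on the left has the derivative of \<xi> as
    left factor, the conclusion has it as right factor; symmetry of \<open>P\<close> exchanges
    them.\<close>
  then have Psym: "v \<bullet> (P *v w) = w \<bullet> (P *v v)" for v w
    by (rule inner_symmetric_matrix)
  have "\<zeta> \<bullet> ((transpose (G2 A Z B) ** P ** G1 \<tau>) *v \<zeta>)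
      = (G2 A Z B *v \<zeta>) \<bullet> (P *v (G1 \<tau> *v \<zeta>))"
    using quadratic_transpose_mult [of \<zeta> "G2 A Z B" "P ** G1 \<tau>"]
    by (simp only: matrix_mul_assoc matrix_vector_mul_assoc)
  then have "\<zeta> \<bullet> ((2 *\<^sub>R sym_part (transpose (G2 A Z B) ** P ** G1 \<tau>)) *v \<zeta>)
      = 2 * (vjoin x (stack (\<lambda>i. \<tau> i *\<^sub>R Y i)) \<bullet> (P *v vjoin f (stack (\<lambda>i. x - X i))))"
    unfolding scaleR_matrix_vector_mult inner_scaleR_right quadratic_sym_part G1_mult G2_mult
      f_def [symmetric] Psym [of "vjoin f _"]
    by simp
  moreover have "\<zeta> \<bullet> ((2 *\<^sub>R sym_part (transpose (G2 A Z B) ** P ** G1 \<tau>)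
      + M1 \<Theta> + M2 \<tau> A Z B \<Omega> \<Gamma> + M3 \<tau> \<Omega> \<Gamma> + M4 \<Gamma> + M5 \<tau> C Cd Ch) *v \<zeta>) \<le> 0"
    by (rule neg_semidefD [OF lmi])
  ultimately show ?thesis
    unfolding matrix_vector_mult_add_rdistrib inner_add_right quadratic_M1 quadratic_M2 [OF sym]
      quadratic_M3 [OF sym] quadratic_M4 [OF sym] quadratic_M5 f_def [symmetric]
    by (simp add: e_def sum_subtractf flip: sum_distrib_left)
qed

end

section \<open>Auxiliary facts on integrals and one-sided derivatives\<close>

lemma integral_nonneg_real:
  fixes f :: "'a::euclidean_space \<Rightarrow> real"
  assumes "\<And>s. s \<in> S \<Longrightarrow> 0 \<le> f s"
  shows "0 \<le> integral S f"
  using assms by (cases "f integrable_on S") (auto intro: integral_nonneg simp: not_integrable_integral)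

lemma has_vector_derivative_vec:
  fixes f :: "real \<Rightarrow> real ^ 'k"
  assumes "\<And>j. ((\<lambda>t. f t $ j) has_vector_derivative f' $ j) (at a within S)"
  shows "(f has_vector_derivative f') (at a within S)"
proof -
  have "((\<lambda>t. f t \<bullet> b) has_derivative (\<lambda>h. (h *\<^sub>R f') \<bullet> b)) (at a within S)" if "b \<in> Basis" for b
  proof -
    obtain j where "b = axis j 1"
      using \<open>b \<in> Basis\<close> by (auto simp: Basis_vec_def)
    then show ?thesis
      using assms [of j] by (simp add: has_vector_derivative_def inner_axis)
  qed
  then show ?thesis
    unfolding has_vector_derivative_def by (subst has_derivative_componentwise_within) blast
qed

lemma has_vector_derivative_nth:
  fixes f :: "real \<Rightarrow> real ^ 'k"
  assumes "(f has_vector_derivative f') F"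
  shows "((\<lambda>t. f t $ j) has_vector_derivative f' $ j) F"
  using bounded_linear.has_vector_derivative [OF bounded_linear_vec_nth assms] .

text \<open>The two sets agree near \<open>s\<close>. This carries calculus on compact intervals
  over to half-lines, where all derivatives in time are taken.\<close>

lemma at_within_Icc_atLeast:
  fixes a b c s :: real
  assumes "a \<le> s" "s < b"
  shows "at s within {a..b} = at s within {a..}"
  using assms by (intro at_within_nhd [of s "{..<b}"]) auto

subsection \<open>Sliding integrals\<close>

text \<open>Only integrability of \<open>k\<close> enters, so this covers quadratic forms of a
  derivative that jumps. At each \<open>u\<close> the compact interval up to \<open>u + 1\<close> is
  used, so that \<open>u\<close> is not its right end.\<close>

lemma continuous_on_integral_atLeast:
  fixes k :: "real \<Rightarrow> 'a::banach"
  assumes "\<And>b. k integrable_on {c..b}"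
  shows "continuous_on {c..} (\<lambda>u. integral {c..u} k)"
  unfolding continuous_on_eq_continuous_within
proof
  fix u assume "u \<in> {c..}"
  then have "continuous (at u within {c..u + 1}) (\<lambda>u. integral {c..u} k)"
    using indefinite_integral_continuous_1 [OF assms, of "u + 1"]
    by (auto simp: continuous_on_eq_continuous_within)
  then show "continuous (at u within {c..}) (\<lambda>u. integral {c..u} k)"
    using \<open>u \<in> {c..}\<close> at_within_Icc_atLeast [of c u "u + 1"] by simp
qed

text \<open>The integral from \<open>c\<close> to \<open>d\<close> is a constant, so continuity is
  required only from \<open>d\<close> on. With \<open>d = 0\<close> this separates the history from
  the solution.\<close>

lemma integral_has_vector_derivative_atLeast:
  fixes k :: "real \<Rightarrow> 'a::banach"
  assumes "c \<le> d" and int: "\<And>b. k integrable_on {c..b}" and cont: "continuous_on {d..} k"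
    and "d \<le> t"
  shows "((\<lambda>u. integral {c..u} k) has_vector_derivative k t) (at t within {d..})"
proof -
  have "((\<lambda>u. integral {d..u} k) has_vector_derivative k t) (at t within {d..t + 1})"
    using \<open>d \<le> t\<close> by (intro integral_has_vector_derivative continuous_on_subset [OF cont]) auto
  then have "((\<lambda>u. integral {c..d} k + integral {d..u} k) has_vector_derivative k t)
      (at t within {d..})"
    using \<open>d \<le> t\<close> at_within_Icc_atLeast [of d t "t + 1"]
    by (auto intro!: derivative_eq_intros)
  then show ?thesis
    by (rule has_vector_derivative_transform [rotated 2])
      (use \<open>d \<le> t\<close> \<open>c \<le> d\<close> int in \<open>auto simp: Henstock_Kurzweil_Integration.integral_combine\<close>)
qed

lemma has_vector_derivative_shift:
  fixes K :: "real \<Rightarrow> 'a::real_normed_vector"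
  assumes "(K has_vector_derivative K') (at (t + h) within (\<lambda>s. s + h) ` S)"
  shows "((\<lambda>s. K (s + h)) has_vector_derivative K') (at t within S)"
proof -
  have "((\<lambda>s. s + h) has_vector_derivative 1) (at t within S)"
    by (auto intro!: derivative_eq_intros)
  from vector_diff_chain_within [OF this assms] show ?thesis
    by (simp add: o_def)
qed

text \<open>The window integral is the difference of two values of the primitive of \<open>k\<close>
  based at \<open>c\<close>, which lies to the left of every window.\<close>

lemma sliding_integral_has_vector_derivative:
  fixes k :: "real \<Rightarrow> 'a::banach"
  assumes "0 \<le> \<tau>" "c \<le> - \<tau>" and cont: "continuous_on {c..} k" and "0 \<le> t"
  shows "((\<lambda>t. integral {t - \<tau>..t} k) has_vector_derivative k t - k (t - \<tau>)) (at t within {0..})"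
proof -
  have int: "k integrable_on {c..b}" for b
    by (intro integrable_continuous_real continuous_on_subset [OF cont]) auto
  have K: "((\<lambda>u. integral {c..u} k) has_vector_derivative k u) (at u within {c..})" if "c \<le> u" for u
    using integral_has_vector_derivative_atLeast [OF _ int cont that] by simp
  have "((\<lambda>s. integral {c..s + (- \<tau>)} k) has_vector_derivative k (t - \<tau>)) (at t within {0..})"
    using assms K [of "t - \<tau>"]
    by (intro has_vector_derivative_shift)
      (auto intro!: has_vector_derivative_within_subset [where S = "{c..}"])
  moreover have "((\<lambda>u. integral {c..u} k) has_vector_derivative k t) (at t within {0..})"
    using assms K [of t] by (auto intro!: has_vector_derivative_within_subset [where S = "{c..}"])
  ultimately have "((\<lambda>s. integral {c..s} k - integral {c..s + (- \<tau>)} k)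
      has_vector_derivative k t - k (t - \<tau>)) (at t within {0..})"
    by (intro has_vector_derivative_diff)
  then show ?thesis
  proof (rule has_vector_derivative_transform [rotated 2])
    show "integral {s - \<tau>..s} k = integral {c..s} k - integral {c..s + (- \<tau>)} k" if "s \<in> {0..}" for s
      using that assms Henstock_Kurzweil_Integration.integral_combine [of c "s - \<tau>" s k] int by (simp add: algebra_simps)
  qed (use assms in auto)
qed

text \<open>With a primitive \<open>K\<close> of \<open>k\<close>, the double integral is
  \<open>\<tau> *\<^sub>R K t\<close> minus the window integral of \<open>K\<close>. As
  \<open>K\<close> is continuous even if \<open>k\<close> is merely integrable on the history, the
  rule for single integrals applies to \<open>K\<close>; thus a jump of \<open>k\<close> at time 0
  does no harm.\<close>

lemma sliding_double_integral_has_vector_derivative: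
  fixes k :: "real \<Rightarrow> 'a::banach"
  assumes "0 \<le> \<tau>" "c \<le> - \<tau>" and int: "\<And>b. k integrable_on {c..b}"
    and cont: "continuous_on {0..} k" and "0 \<le> t"
  shows "((\<lambda>t. integral {t - \<tau>..t} (\<lambda>s. integral {s..t} k))
    has_vector_derivative \<tau> *\<^sub>R k t - integral {t - \<tau>..t} k) (at t within {0..})"
proof -
  define K where "K = (\<lambda>u. integral {c..u} k)"
  have K: "integral {s..t} k = K t - K s" if "c \<le> s" "s \<le> t" for s t
    using Henstock_Kurzweil_Integration.integral_combine [OF that int] by (simp add: K_def algebra_simps)
  have contK: "continuous_on {c..} K"
    unfolding K_def by (rule continuous_on_integral_atLeast) (rule int)
  have "((\<lambda>t. \<tau> *\<^sub>R K t) has_vector_derivative \<tau> *\<^sub>R k t) (at t within {0..})"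
    unfolding K_def using assms
    by (intro bounded_linear.has_vector_derivative [OF bounded_linear_scaleR_right]
        integral_has_vector_derivative_atLeast) auto
  from has_vector_derivative_diff [OF this
      sliding_integral_has_vector_derivative [OF assms(1,2) contK \<open>0 \<le> t\<close>]]
  have "((\<lambda>t. \<tau> *\<^sub>R K t - integral {t - \<tau>..t} K) has_vector_derivative
      \<tau> *\<^sub>R k t - integral {t - \<tau>..t} k) (at t within {0..})"
    using assms by (simp add: K)
  then show ?thesis
  proof (rule has_vector_derivative_transform [rotated 2])
    show "integral {s - \<tau>..s} (\<lambda>v. integral {v..s} k) = \<tau> *\<^sub>R K s - integral {s - \<tau>..s} K"
      if "s \<in> {0..}" for s
    proof -
      have "integral {s - \<tau>..s} (\<lambda>v. integral {v..s} k) = integral {s - \<tau>..s} (\<lambda>v. K s - K v)"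
        using that assms by (intro integral_cong) (simp add: K)
      also have "\<dots> = integral {s - \<tau>..s} (\<lambda>v. K s) - integral {s - \<tau>..s} K"
        using that assms
        by (intro integral_diff integrable_continuous_real continuous_on_subset [OF contK]) auto
      finally show ?thesis
        using \<open>0 \<le> \<tau>\<close> by simp
    qed
  qed (use assms in auto)
qed

subsection \<open>The Jensen and Wirtinger inequalities\<close>

text \<open>Bessel's inequality for \<open>g\<close> and the first two Legendre polynomials on \<open>[a, b]\<close>.\<close>

lemma integral_quadratic_ge:
  fixes M :: "real ^ 'n ^ 'n" and g :: "real \<Rightarrow> real ^ 'n"
  assumes "a < b" and M: "pos_semidef M"
    and g: "(g has_integral d) {a..b}"
    and h: "((\<lambda>s. (s - (a + b) / 2) *\<^sub>R g s) has_integral h) {a..b}"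
    and E: "((\<lambda>s. g s \<bullet> (M *v g s)) has_integral E) {a..b}"
  shows "d \<bullet> (M *v d) + 12 / (b - a)\<^sup>2 * (h \<bullet> (M *v h)) \<le> (b - a) * E"
proof -
  define T m where "T = b - a" and "m = (a + b) / 2"
  \<comment> \<open>The affine function \<open>p + (s - m) *\<^sub>R q\<close> is the least-squares
    approximation of \<open>g\<close>: \<open>p\<close> is the mean, and \<open>q\<close> is the
    first moment divided by the integral of \<open>(s - m)\<^sup>2\<close>, which is
    \<open>T ^ 3 / 12\<close>.\<close>
  define p q where "p = (1 / T) *\<^sub>R d" and "q = (12 / T ^ 3) *\<^sub>R h"
  have "T > 0"
    using \<open>a < b\<close> by (simp add: T_def)
  have sym: "v \<bullet> (M *v w) = w \<bullet> (M *v v)" for v w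
    by (rule inner_symmetric_matrix) (use M in \<open>simp add: pos_semidef_def\<close>)
  have lin: "((\<lambda>s. s - m) has_integral 0) {a..b}"
  proof -
    have "((\<lambda>s. s - m) has_integral ((b - m)\<^sup>2 / 2 - (a - m)\<^sup>2 / 2)) {a..b}"
      using \<open>a < b\<close> by (intro fundamental_theorem_of_calculus)
        (auto intro!: derivative_eq_intros simp flip: has_real_derivative_iff_has_vector_derivative)
    then show ?thesis
      by (simp add: m_def power2_eq_square field_simps)
  qed
  have sq: "((\<lambda>s. (s - m)\<^sup>2) has_integral T ^ 3 / 12) {a..b}"
  proof -
    have "((\<lambda>s. (s - m)\<^sup>2) has_integral ((b - m) ^ 3 / 3 - (a - m) ^ 3 / 3)) {a..b}"
      using \<open>a < b\<close> by (intro fundamental_theorem_of_calculus)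
        (auto intro!: derivative_eq_intros simp flip: has_real_derivative_iff_has_vector_derivative)
    moreover have "(b - m) ^ 3 / 3 - (a - m) ^ 3 / 3 = T ^ 3 / 12"
      by (simp add: m_def T_def power3_eq_cube field_simps)
    ultimately show ?thesis by simp
  qed
  \<comment> \<open>The mixed term in \<open>p\<close> and \<open>q\<close> is a multiple of
    \<open>s - m\<close>, so its integral vanishes by \<open>lin\<close>.\<close>
  have expand: "(g s - p - (s - m) *\<^sub>R q) \<bullet> (M *v (g s - p - (s - m) *\<^sub>R q))
      = g s \<bullet> (M *v g s) - 2 * ((M *v p) \<bullet> g s) - 2 * ((M *v q) \<bullet> ((s - m) *\<^sub>R g s))
        + p \<bullet> (M *v p) + (s - m) * (2 * (p \<bullet> (M *v q))) + (s - m)\<^sup>2 * (q \<bullet> (M *v q))" for s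
    by (simp add: matrix_vector_mult_diff_distrib matrix_vector_mult_scaleR inner_diff_left
        inner_diff_right inner_commute [of "M *v p"] inner_commute [of "M *v q"] sym [of p "g s"]
        sym [of q "g s"] sym [of q p] power2_eq_square algebra_simps)
  have "((\<lambda>s. g s \<bullet> (M *v g s) - 2 * ((M *v p) \<bullet> g s) - 2 * ((M *v q) \<bullet> ((s - m) *\<^sub>R g s))
        + p \<bullet> (M *v p) + (s - m) * (2 * (p \<bullet> (M *v q))) + (s - m)\<^sup>2 * (q \<bullet> (M *v q)))
      has_integral E - 2 * ((M *v p) \<bullet> d) - 2 * ((M *v q) \<bullet> h)
        + T *\<^sub>R (p \<bullet> (M *v p)) + 0 * (2 * (p \<bullet> (M *v q))) + T ^ 3 / 12 * (q \<bullet> (M *v q))) {a..b}"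
    unfolding T_def using \<open>a < b\<close> E has_integral_const_real [of "p \<bullet> (M *v p)" a b]
    by (intro has_integral_add has_integral_diff has_integral_mult_right has_integral_mult_left
        has_integral_linear [OF g bounded_linear_inner_right, unfolded o_def]
        has_integral_linear [OF h [folded m_def] bounded_linear_inner_right, unfolded o_def]
        lin sq [unfolded T_def]) auto
  then have "((\<lambda>s. (g s - p - (s - m) *\<^sub>R q) \<bullet> (M *v (g s - p - (s - m) *\<^sub>R q)))
      has_integral E - 2 * ((M *v p) \<bullet> d) - 2 * ((M *v q) \<bullet> h)
        + T * (p \<bullet> (M *v p)) + T ^ 3 / 12 * (q \<bullet> (M *v q))) {a..b}"
    by (simp only: expand) simp
  \<comment> \<open>The form of the residual is nonnegative at every \<open>s\<close>; with the
    chosen \<open>p\<close> and \<open>q\<close> its integral is \<open>E\<close> minus the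
    contributions of the two coefficients.\<close>
  then have "0 \<le> E - 2 * ((M *v p) \<bullet> d) - 2 * ((M *v q) \<bullet> h)
        + T * (p \<bullet> (M *v p)) + T ^ 3 / 12 * (q \<bullet> (M *v q))"
    by (rule has_integral_nonneg) (use M in \<open>simp add: pos_semidef_def\<close>)
  also have "\<dots> = E - (d \<bullet> (M *v d)) / T - 12 / T ^ 3 * (h \<bullet> (M *v h))"
    using \<open>T > 0\<close>
    by (simp add: p_def q_def matrix_vector_mult_scaleR inner_commute field_simps power2_eq_square
        power3_eq_cube)
  finally have "0 \<le> T * (E - (d \<bullet> (M *v d)) / T - 12 / T ^ 3 * (h \<bullet> (M *v h)))"
    using \<open>T > 0\<close> by simp
  also have "\<dots> = T * E - (d \<bullet> (M *v d) + 12 / T\<^sup>2 * (h \<bullet> (M *v h)))"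
    using \<open>T > 0\<close> by (simp add: field_simps power2_eq_square power3_eq_cube)
  finally show ?thesis
    by (simp add: T_def)
qed

text \<open>Only the constant Legendre term is kept; the first-moment term is nonnegative and is
  dropped.\<close>

lemma jensen_quadratic:
  fixes M :: "real ^ 'n ^ 'n" and x :: "real \<Rightarrow> real ^ 'n"
  assumes "a < b" and M: "pos_semidef M" and x: "continuous_on {a..b} x"
  shows "integral {a..b} x \<bullet> (M *v integral {a..b} x) \<le> (b - a) * integral {a..b} (\<lambda>s. x s \<bullet> (M *v x s))"
proof -
  let ?h = "integral {a..b} (\<lambda>s. (s - (a + b) / 2) *\<^sub>R x s)"
  have "integral {a..b} x \<bullet> (M *v integral {a..b} x) + 12 / (b - a)\<^sup>2 * (?h \<bullet> (M *v ?h))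
      \<le> (b - a) * integral {a..b} (\<lambda>s. x s \<bullet> (M *v x s))"
    by (rule integral_quadratic_ge [where g = x, OF \<open>a < b\<close> M]; intro integrable_integral integrable_continuous_real
        continuous_intros x bounded_linear.continuous_on [OF matrix_vector_mul_bounded_linear])
  moreover have "0 \<le> ?h \<bullet> (M *v ?h)"
    using M by (simp add: pos_semidef_def)
  ultimately show ?thesis
    using \<open>a < b\<close> by (smt (verit, best) divide_nonneg_nonneg mult_nonneg_nonneg zero_le_power2)
qed

text \<open>Bessel's inequality applied to the derivative \<open>g\<close> of \<open>x\<close>, with
  both Legendre terms kept. The finite set \<open>S\<close> admits kinks of \<open>x\<close>; the
  fundamental theorem of calculus tolerates them because \<open>x\<close> is continuous.\<close>

lemma wirtinger_quadratic:
  fixes M :: "real ^ 'n ^ 'n" and x g :: "real \<Rightarrow> real ^ 'n"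
  assumes "a < b" and M: "pos_semidef M" and x: "continuous_on {a..b} x"
    and "finite S" and deriv: "\<And>s. s \<in> {a<..<b} - S \<Longrightarrow> (x has_vector_derivative g s) (at s)"
    and E: "(\<lambda>s. g s \<bullet> (M *v g s)) integrable_on {a..b}"
  defines "e \<equiv> x b + x a - (2 / (b - a)) *\<^sub>R integral {a..b} x"
  shows "(x b - x a) \<bullet> (M *v (x b - x a)) + 3 * (e \<bullet> (M *v e))
    \<le> (b - a) * integral {a..b} (\<lambda>s. g s \<bullet> (M *v g s))"
proof -
  define m where "m = (a + b) / 2"
  \<comment> \<open>Integration by parts: the integrand is the derivative of
    \<open>(s - m) *\<^sub>R x s\<close>. Subtracting the integral of \<open>x\<close> leaves the
    first moment of \<open>g\<close>, which is \<open>((b - a) / 2) *\<^sub>R e\<close>.\<close>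
  have "((\<lambda>s. (s - m) *\<^sub>R g s + x s) has_integral (b - m) *\<^sub>R x b - (a - m) *\<^sub>R x a) {a..b}"
    using \<open>a < b\<close> by (intro fundamental_theorem_of_calculus_interior_strong [OF \<open>finite S\<close>])
      (auto intro!: derivative_eq_intros deriv continuous_intros x simp: has_real_derivative_iff_has_vector_derivative)
  moreover have "(x has_integral integral {a..b} x) {a..b}"
    by (intro integrable_integral integrable_continuous_real x)
  ultimately have "((\<lambda>s. ((s - m) *\<^sub>R g s + x s) - x s) has_integral
      (b - m) *\<^sub>R x b - (a - m) *\<^sub>R x a - integral {a..b} x) {a..b}"
    by (rule has_integral_diff)
  moreover have "(b - m) *\<^sub>R x b - (a - m) *\<^sub>R x a - integral {a..b} x = ((b - a) / 2) *\<^sub>R e"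
  proof -
    have m: "b - m = (b - a) / 2" "a - m = - ((b - a) / 2)"
      by (auto simp: m_def field_simps)
    have "(b - a) / 2 * (2 / (b - a)) = 1"
      using \<open>a < b\<close> by simp
    then show ?thesis
      by (simp only: m e_def scaleR_right_distrib scaleR_right_diff_distrib scaleR_scaleR) simp
  qed
  ultimately have "((\<lambda>s. (s - (a + b) / 2) *\<^sub>R g s) has_integral ((b - a) / 2) *\<^sub>R e) {a..b}"
    by (simp add: m_def)
  moreover have "(g has_integral x b - x a) {a..b}"
    using \<open>a < b\<close> deriv x
    by (intro fundamental_theorem_of_calculus_interior_strong [OF \<open>finite S\<close>]) auto
  ultimately have "(x b - x a) \<bullet> (M *v (x b - x a))
      + 12 / (b - a)\<^sup>2 * ((((b - a) / 2) *\<^sub>R e) \<bullet> (M *v (((b - a) / 2) *\<^sub>R e)))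
    \<le> (b - a) * integral {a..b} (\<lambda>s. g s \<bullet> (M *v g s))"
    using integral_quadratic_ge [OF \<open>a < b\<close> M] E by blast
  moreover have "12 / (b - a)\<^sup>2 * ((((b - a) / 2) *\<^sub>R e) \<bullet> (M *v (((b - a) / 2) *\<^sub>R e)))
      = 3 * (e \<bullet> (M *v e))"
  proof -
    \<comment> \<open>The factor 3 of the Wirtinger inequality: 12 from the Legendre norm times the
      square of one half from the first moment.\<close>
    have *: "12 / T\<^sup>2 * (T / 2 * (T / 2 * y)) = 3 * y" if "T \<noteq> 0" for T y :: real
      using that by (simp add: power2_eq_square)
    show ?thesis
      unfolding matrix_vector_mult_scaleR inner_scaleR_left inner_scaleR_right
      by (rule *) (use \<open>a < b\<close> in simp)
  qed
  ultimately show ?thesis by simp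
qed

subsection \<open>Solutions and the storage functional along them\<close>

lemma \<xi>_eq_vjoin: "\<xi> \<tau> \<psi> = vjoin (\<psi> 0) (stack (\<lambda>i. integral {- \<tau> i..0} \<psi>))"
  by (simp add: \<xi>_def vjoin_def stack_def vec_eq_iff split: sum.split)

lemma delay_le_max_delay:
  fixes \<tau> :: "'q::{finite,linorder} \<Rightarrow> real"
  assumes "mono \<tau>"
  shows "\<tau> i \<le> max_delay \<tau>"
  using monoD [OF assms, of i "Max UNIV"] by (simp add: max_delay_def)

text \<open>The claim covers arbitrary \<open>\<psi>\<close>: where an integrand is not integrable,
  its integral is 0 by convention.\<close>

lemma storage_nonneg:
  assumes "\<And>i. 0 < \<tau> i" "pos_semidef P"
    and "\<And>i. pos_semidef (\<Theta> i)" "\<And>i. pos_semidef (\<Omega> i)" "\<And>i. pos_semidef (\<Gamma> i)"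
  shows "0 \<le> storage \<tau> P \<Theta> \<Omega> \<Gamma> \<psi>"
  unfolding storage_def Let_def
  using assms unfolding pos_semidef_def
  by (intro add_nonneg_nonneg sum_nonneg mult_nonneg_nonneg integral_nonneg_real) (auto simp: less_imp_le)

lemma storage_zero:
  fixes \<tau> :: "'q::{finite,linorder} \<Rightarrow> real"
    and P :: "real ^ ('n::finite + 'q \<times> 'n) ^ ('n + 'q \<times> 'n)"
  assumes pos: "\<And>i. 0 < \<tau> i" and "mono \<tau>"
  shows "storage \<tau> P \<Theta> \<Omega> \<Gamma> (\<lambda>s\<in>{- max_delay \<tau>..0}. 0) = 0"
proof -
  define r where "r = max_delay \<tau>"
  define z where "z = (\<lambda>s\<in>{- r..0}. 0 :: real ^ 'n)"
  have le: "0 < \<tau> i" "\<tau> i \<le> r" for i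
    using pos delay_le_max_delay [OF \<open>mono \<tau>\<close>] by (auto simp: r_def)
  then have "0 < r"
    using less_le_trans by blast
  have z: "z s = 0" if "- r \<le> s" "s \<le> 0" for s
    using that by (simp add: z_def)
  \<comment> \<open>Outside the interval \<open>z\<close> is \<open>undefined\<close>, so the
    derivative has to be taken within the interval; it is unique there because the interval is
    nondegenerate.\<close>
  have D: "vector_derivative z (at v within {- r..0}) = 0" if "- r \<le> v" "v \<le> 0" for v
  proof (rule vector_derivative_within_closed_interval)
    show "(z has_vector_derivative 0) (at v within {- r..0})"
      by (rule has_vector_derivative_transform [OF _ _ has_vector_derivative_const [of 0]])
        (use that z in auto)
  qed (use that \<open>0 < r\<close> in auto)
  have zi: "integral {- \<tau> i..0} z = 0" for i
    using le(2) [of i] by (subst integral_cong [of _ z "\<lambda>_. 0"]) (auto intro: z)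
  have "storage \<tau> P \<Theta> \<Omega> \<Gamma> z
    = (\<Sum>i\<in>UNIV. integral {- \<tau> i..0} (\<lambda>s. 0))
      + (\<Sum>i\<in>UNIV. \<tau> i * integral {- \<tau> i..0} (\<lambda>s. integral {s..0} (\<lambda>v. 0)))
      + (\<Sum>i\<in>UNIV. \<tau> i * integral {- \<tau> i..0} (\<lambda>s. integral {s..0} (\<lambda>v. 0)))"
  proof -
    have "integral {- \<tau> i..0} (\<lambda>s. z s \<bullet> (\<Theta> i *v z s)) = integral {- \<tau> i..0} (\<lambda>s. 0)" for i
      using le(2) [of i] by (intro integral_cong) (simp add: z)
    moreover have "integral {- \<tau> i..0} (\<lambda>s. integral {s..0} (\<lambda>v. z v \<bullet> (\<Omega> i *v z v)))
        = integral {- \<tau> i..0} (\<lambda>s. integral {s..0} (\<lambda>v. 0))" for i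
      using le(2) [of i] by (intro integral_cong) (simp add: z)
    moreover have "integral {- \<tau> i..0} (\<lambda>s. integral {s..0} (\<lambda>v.
          vector_derivative z (at v within {- r..0}) \<bullet> (\<Gamma> i *v vector_derivative z (at v within {- r..0}))))
        = integral {- \<tau> i..0} (\<lambda>s. integral {s..0} (\<lambda>v. 0))" for i
      using le(2) [of i] by (intro integral_cong) (simp add: D)
    moreover have "\<xi> \<tau> z = 0"
      using \<open>0 < r\<close> by (simp add: \<xi>_eq_vjoin zi z stack_def vjoin_def vec_eq_iff split: sum.split)
    ultimately show ?thesis
      unfolding storage_def Let_def r_def [symmetric] by simp
  qed
  then show ?thesis
    by (simp add: z_def r_def)
qed

text \<open>One function \<open>g\<close> serves as derivative on history and future. At time 0 the
  one-sided derivatives may differ; hence the derivative within the whole half-line is claimed only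
  away from 0, and across 0 the quadratic forms of \<open>g\<close> are integrable rather than
  continuous.\<close>

lemma solution_derivative:
  fixes \<tau> :: "'q::{finite,linorder} \<Rightarrow> real" and x :: "real \<Rightarrow> real ^ 'n"
  assumes pos: "\<And>i. 0 < \<tau> i" and "mono \<tau>"
    and \<phi>: "\<phi> \<in> histories (max_delay \<tau>)" and u: "continuous_on {0..} u"
    and sol: "delay_solution \<tau> A Z B u \<phi> x"
  obtains g where "continuous_on {- max_delay \<tau>..} x" and "continuous_on {0..} g"
    and "\<forall>t\<ge>0. g t = A *v x t + (\<Sum>i\<in>UNIV. Z i *v x (t - \<tau> i)) + B *v u t"
    and "\<forall>t\<ge>0. (x has_vector_derivative g t) (at t within {0..})"
    and "\<forall>t\<ge>- max_delay \<tau>. t \<noteq> 0 \<longrightarrow>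
      (x has_vector_derivative g t) (at t within {- max_delay \<tau>..})"
    and "\<forall>(M :: real ^ 'n ^ 'n) b. (\<lambda>s. g s \<bullet> (M *v g s)) integrable_on {- max_delay \<tau>..b}"
proof -
  define r where "r = max_delay \<tau>"
  have le: "0 < \<tau> i" "\<tau> i \<le> r" for i
    using pos delay_le_max_delay [OF \<open>mono \<tau>\<close>] by (auto simp: r_def)
  then have "0 < r"
    using less_le_trans by blast
  obtain \<phi>' where \<phi>': "continuous_on {- r..0} \<phi>'"
    and d\<phi>: "\<And>s. s \<in> {- r..0} \<Longrightarrow> (\<phi> has_vector_derivative \<phi>' s) (at s within {- r..0})"
    using \<phi> by (auto simp: histories_def C1_on_def r_def)
  have x\<phi>: "x s = \<phi> s" if "s \<in> {- r..0}" for s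
    using sol that by (simp add: delay_solution_def r_def)
  define f where "f t = A *v x t + (\<Sum>i\<in>UNIV. Z i *v x (t - \<tau> i)) + B *v u t" for t
  \<comment> \<open>At 0 the value from the differential equation is taken, which makes
    \<open>g\<close> continuous on \<open>{0..}\<close>.\<close>
  define g where "g t = (if t < 0 then \<phi>' t else f t)" for t
  have dx0: "(x has_vector_derivative g t) (at t within {0..})" if "0 \<le> t" for t
    using sol that by (simp add: delay_solution_def g_def f_def)
  have dx1: "(x has_vector_derivative \<phi>' s) (at s within {- r..0})" if "s \<in> {- r..0}" for s
    by (rule has_vector_derivative_transform [OF that x\<phi> d\<phi> [OF that]])
  have dx2: "(x has_vector_derivative g t) (at t within {- r..})" if "- r \<le> t" "t \<noteq> 0" for t
  proof (cases "t < 0")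
    case True
    then show ?thesis
      using dx1 [of t] that at_within_Icc_atLeast [of "- r" t 0] by (simp add: g_def)
  next
    case False
    then have "at t within {0..} = at t within {- r..}"
      using that \<open>0 < r\<close> by (intro at_within_nhd [of t "{0<..}"]) auto
    then show ?thesis
      using dx0 [of t] False by simp
  qed
  have cx: "continuous_on {- r..} x"
  proof -
    have "continuous_on {- r..0} x"
      unfolding continuous_on_eq_continuous_within by (blast intro: has_vector_derivative_continuous dx1)
    moreover have "continuous_on {0..} x"
      unfolding continuous_on_eq_continuous_within
      by (intro ballI has_vector_derivative_continuous [OF dx0]) simp
    ultimately have "continuous_on ({- r..0} \<union> {0..}) x"
      by (intro continuous_on_closed_Un) auto
    moreover have "{- r..0} \<union> {0..} = {- r..}"
      using \<open>0 < r\<close> by auto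
    ultimately show ?thesis by simp
  qed
  have cf: "continuous_on {0..} f"
  proof -
    have "continuous_on {0..} (\<lambda>t. x (t - \<tau> i))" for i
      by (rule continuous_on_compose2 [OF cx]) (use le(2) [of i] in \<open>auto intro!: continuous_intros\<close>)
    moreover have "continuous_on {0..} x"
      by (rule continuous_on_subset [OF cx]) (use \<open>0 < r\<close> in auto)
    ultimately show ?thesis
      unfolding f_def
      by (intro continuous_intros u bounded_linear.continuous_on [OF matrix_vector_mul_bounded_linear])
  qed
  have cg: "continuous_on {0..} g"
    using cf by (rule continuous_on_eq) (simp add: g_def)
  have int: "(\<lambda>s. g s \<bullet> (M *v g s)) integrable_on {- r..b}" for M :: "real ^ 'n ^ 'n" and b
  proof -
    have quad: "continuous_on S (\<lambda>s. k s \<bullet> (M *v k s))" if "continuous_on S k" for S k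
      by (intro continuous_intros that bounded_linear.continuous_on [OF matrix_vector_mul_bounded_linear])
    have "(\<lambda>s. \<phi>' s \<bullet> (M *v \<phi>' s)) integrable_on {- r..0}"
      by (intro integrable_continuous_real quad \<phi>')
    \<comment> \<open>On the history interval \<open>g\<close> and \<open>\<phi>'\<close> can differ
      only at 0, a null set.\<close>
    then have 1: "(\<lambda>s. g s \<bullet> (M *v g s)) integrable_on {- r..0}"
      by (rule integrable_spike_finite [of "{0}", rotated 2]) (auto simp: g_def)
    \<comment> \<open>The absolute value guarantees an upper end to the right of 0, so that the two
      pieces can be joined; the interval up to \<open>b\<close> is then a subinterval.\<close>
    have 2: "(\<lambda>s. g s \<bullet> (M *v g s)) integrable_on {0..\<bar>b\<bar>}"
      by (intro integrable_continuous_real quad continuous_on_subset [OF cg]) auto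
    have "(\<lambda>s. g s \<bullet> (M *v g s)) integrable_on {- r..\<bar>b\<bar>}"
      by (rule Henstock_Kurzweil_Integration.integrable_combine [OF _ _ 1 2]) (use \<open>0 < r\<close> in simp_all)
    then show ?thesis
      by (rule integrable_subinterval_real) auto
  qed
  show thesis
    by (rule that [of g, folded r_def, OF cx cg]) (auto simp: dx0 dx2 int, simp add: g_def f_def)
qed

section \<open>The storage functional on segments of a trajectory\<close>

lemma integral_shift_0:
  fixes f :: "real \<Rightarrow> 'a::banach"
  shows "integral {a..0} (\<lambda>s. f (t + s)) = integral {t + a..t} f"
  using integral_shift_Icc_real [of a 0 f t] by (simp add: o_def add.commute)

lemma integral_integral_shift_0:
  fixes f :: "real \<Rightarrow> 'a::banach"
  shows "integral {a..0} (\<lambda>s. integral {s..0} (\<lambda>v. f (t + v)))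
    = integral {t + a..t} (\<lambda>s. integral {s..t} f)"
  using integral_shift_0 [of a "\<lambda>s. integral {s..t} f" t] by (simp add: integral_shift_0)

text \<open>Substituting \<open>t + s\<close> for \<open>s\<close> turns integrals over the segment
  into integrals over the sliding window, the form that can be differentiated in
  \<open>t\<close>.\<close>

lemma storage_segment:
  fixes \<tau> :: "'q::{finite,linorder} \<Rightarrow> real" and x g :: "real \<Rightarrow> real ^ 'n"
  assumes pos: "\<And>i. 0 < \<tau> i" and "mono \<tau>" and "0 \<le> t"
    and deriv: "\<And>t. - max_delay \<tau> \<le> t \<Longrightarrow> t \<noteq> 0 \<Longrightarrow>
      (x has_vector_derivative g t) (at t within {- max_delay \<tau>..})"
  defines "z \<equiv> vjoin (x t) (stack (\<lambda>i. integral {t - \<tau> i..t} x))"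
  shows "storage \<tau> P \<Theta> \<Omega> \<Gamma> (segment (max_delay \<tau>) x t)
    = z \<bullet> (P *v z)
      + (\<Sum>i\<in>UNIV. integral {t - \<tau> i..t} (\<lambda>s. x s \<bullet> (\<Theta> i *v x s)))
      + (\<Sum>i\<in>UNIV. \<tau> i * integral {t - \<tau> i..t} (\<lambda>s. integral {s..t} (\<lambda>v. x v \<bullet> (\<Omega> i *v x v))))
      + (\<Sum>i\<in>UNIV. \<tau> i * integral {t - \<tau> i..t} (\<lambda>s. integral {s..t} (\<lambda>v. g v \<bullet> (\<Gamma> i *v g v))))"
proof -
  define r where "r = max_delay \<tau>"
  define \<psi> where "\<psi> = segment r x t"
  define D where "D v = vector_derivative \<psi> (at v within {- r..0})" for v
  have le: "0 < \<tau> i" "\<tau> i \<le> r" for i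
    using pos delay_le_max_delay [OF \<open>mono \<tau>\<close>] by (auto simp: r_def)
  then have "0 < r"
    using less_le_trans by blast
  have \<psi>: "\<psi> s = x (t + s)" if "- r \<le> s" "s \<le> 0" for s
    using that by (simp add: \<psi>_def segment_def)
  \<comment> \<open>The point \<open>- t\<close> of the segment corresponds to time 0, where the
    trajectory may have a kink and \<open>vector_derivative\<close> carries no information.\<close>
  have D: "D v = g (t + v)" if "- r \<le> v" "v \<le> 0" "v \<noteq> - t" for v
    unfolding D_def
  proof (rule vector_derivative_within_closed_interval)
    have "(x has_vector_derivative g (v + t)) (at (v + t) within (\<lambda>s. s + t) ` {- r..0})"
      by (rule has_vector_derivative_within_subset [OF deriv])
        (use that \<open>0 \<le> t\<close> in \<open>auto simp flip: r_def\<close>)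
    then have "((\<lambda>s. x (s + t)) has_vector_derivative g (v + t)) (at v within {- r..0})"
      by (rule has_vector_derivative_shift)
    then show "(\<psi> has_vector_derivative g (t + v)) (at v within {- r..0})"
      unfolding add.commute [of v t]
      by (rule has_vector_derivative_transform [rotated 2]) (use that in \<open>auto simp: \<psi> add.commute\<close>)
  qed (use that \<open>0 < r\<close> in auto)
  have x: "integral {- \<tau> i..0} \<psi> = integral {t - \<tau> i..t} x" for i
  proof -
    have "integral {- \<tau> i..0} \<psi> = integral {- \<tau> i..0} (\<lambda>s. x (t + s))"
      using le(2) [of i] by (intro integral_cong) (simp add: \<psi>)
    then show ?thesis by (simp add: integral_shift_0)
  qed
  have \<Theta>: "integral {- \<tau> i..0} (\<lambda>s. \<psi> s \<bullet> (\<Theta> i *v \<psi> s))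
      = integral {t - \<tau> i..t} (\<lambda>s. x s \<bullet> (\<Theta> i *v x s))" for i
  proof -
    have "integral {- \<tau> i..0} (\<lambda>s. \<psi> s \<bullet> (\<Theta> i *v \<psi> s))
        = integral {- \<tau> i..0} (\<lambda>s. x (t + s) \<bullet> (\<Theta> i *v x (t + s)))"
      using le(2) [of i] by (intro integral_cong) (simp add: \<psi>)
    also have "\<dots> = integral {t - \<tau> i..t} (\<lambda>s. x s \<bullet> (\<Theta> i *v x s))"
      using integral_shift_0 [of "- \<tau> i" "\<lambda>s. x s \<bullet> (\<Theta> i *v x s)" t] by simp
    finally show ?thesis .
  qed
  have \<Omega>: "integral {- \<tau> i..0} (\<lambda>s. integral {s..0} (\<lambda>v. \<psi> v \<bullet> (\<Omega> i *v \<psi> v)))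
      = integral {t - \<tau> i..t} (\<lambda>s. integral {s..t} (\<lambda>v. x v \<bullet> (\<Omega> i *v x v)))" for i
  proof -
    have "integral {- \<tau> i..0} (\<lambda>s. integral {s..0} (\<lambda>v. \<psi> v \<bullet> (\<Omega> i *v \<psi> v)))
        = integral {- \<tau> i..0} (\<lambda>s. integral {s..0} (\<lambda>v. x (t + v) \<bullet> (\<Omega> i *v x (t + v))))"
      using le(2) [of i] by (intro integral_cong) (simp add: \<psi>)
    also have "\<dots> = integral {t - \<tau> i..t} (\<lambda>s. integral {s..t} (\<lambda>v. x v \<bullet> (\<Omega> i *v x v)))"
      using integral_integral_shift_0 [of "- \<tau> i" "\<lambda>s. x s \<bullet> (\<Omega> i *v x s)" t] by simp
    finally show ?thesis .
  qed
  have \<Gamma>: "integral {- \<tau> i..0} (\<lambda>s. integral {s..0} (\<lambda>v. D v \<bullet> (\<Gamma> i *v D v)))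
      = integral {t - \<tau> i..t} (\<lambda>s. integral {s..t} (\<lambda>v. g v \<bullet> (\<Gamma> i *v g v)))" for i
  proof -
    have *: "integral {s..0} (\<lambda>v. D v \<bullet> (\<Gamma> i *v D v))
        = integral {s..0} (\<lambda>v. g (t + v) \<bullet> (\<Gamma> i *v g (t + v)))" if "s \<in> {- \<tau> i..0}" for s
      \<comment> \<open>The single exceptional point does not change the inner integral.\<close>
      by (rule integral_spike [of "{- t}"]) (use that le(2) [of i] in \<open>auto simp: D\<close>)
    have "integral {- \<tau> i..0} (\<lambda>s. integral {s..0} (\<lambda>v. D v \<bullet> (\<Gamma> i *v D v)))
        = integral {- \<tau> i..0} (\<lambda>s. integral {s..0} (\<lambda>v. g (t + v) \<bullet> (\<Gamma> i *v g (t + v))))"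
      by (rule integral_cong) (rule *)
    also have "\<dots> = integral {t - \<tau> i..t} (\<lambda>s. integral {s..t} (\<lambda>v. g v \<bullet> (\<Gamma> i *v g v)))"
      using integral_integral_shift_0 [of "- \<tau> i" "\<lambda>s. g s \<bullet> (\<Gamma> i *v g s)" t] by simp
    finally show ?thesis .
  qed
  have "\<psi> 0 = x t"
    using \<psi> [of 0] \<open>0 < r\<close> by simp
  then have "\<xi> \<tau> \<psi> = z"
    by (simp add: \<xi>_eq_vjoin z_def x)
  then show ?thesis
    unfolding storage_def Let_def r_def [symmetric] \<psi>_def [symmetric] D_def [symmetric] \<Theta> \<Omega> \<Gamma>
    by simp
qed

text \<open>Symmetry of \<open>P\<close> makes the two terms of the product rule equal.\<close>

lemma quadratic_form_has_vector_derivative: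
  fixes P :: "real ^ 'k ^ 'k"
  assumes P: "transpose P = P" and z: "(z has_vector_derivative z') (at t within S)"
  shows "((\<lambda>t. z t \<bullet> (P *v z t)) has_vector_derivative 2 * (z t \<bullet> (P *v z'))) (at t within S)"
proof -
  have "((\<lambda>t. P *v z t) has_vector_derivative P *v z') (at t within S)"
    by (rule bounded_linear.has_vector_derivative [OF matrix_vector_mul_bounded_linear z])
  from bounded_bilinear.has_vector_derivative [OF bounded_bilinear_inner z this]
  show ?thesis
    by (simp add: inner_symmetric_matrix [OF P, of z' "z t"])
qed

lemma vjoin_stack_has_vector_derivative:
  fixes x :: "real \<Rightarrow> real ^ 'n" and Y :: "'q::finite \<Rightarrow> real \<Rightarrow> real ^ 'n"
  assumes "(x has_vector_derivative x') (at t within S)"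
    and "\<And>i. (Y i has_vector_derivative Y' i) (at t within S)"
  shows "((\<lambda>t. vjoin (x t) (stack (\<lambda>i. Y i t))) has_vector_derivative vjoin x' (stack Y'))
    (at t within S)"
proof (rule has_vector_derivative_vec)
  fix j :: "'n + 'q \<times> 'n"
  show "((\<lambda>t. vjoin (x t) (stack (\<lambda>i. Y i t)) $ j) has_vector_derivative
      vjoin x' (stack Y') $ j) (at t within S)"
    using assms by (cases j) (auto simp: vjoin_def stack_def intro!: has_vector_derivative_nth)
qed

section \<open>The dissipation inequality along solutions\<close>

lemma storage_decrease:
  fixes \<tau> :: "'q::{finite,linorder} \<Rightarrow> real"
    and A :: "real ^ 'n ^ 'n"
    and Z :: "'q \<Rightarrow> real ^ 'n ^ 'n"
    and B :: "real ^ 'm ^ 'n"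
    and C :: "real ^ 'n ^ 'm"
    and Cd Ch :: "'q \<Rightarrow> real ^ 'n ^ 'm"
    and P :: "real ^ ('n + 'q \<times> 'n) ^ ('n + 'q \<times> 'n)"
    and \<Theta> \<Omega> \<Gamma> :: "'q \<Rightarrow> real ^ 'n ^ 'n"
  assumes pos: "\<And>i. 0 < \<tau> i" and mono: "mono \<tau>" and P: "pos_semidef P"
    and \<Omega>: "\<And>i. pos_semidef (\<Omega> i)" and \<Gamma>: "\<And>i. pos_semidef (\<Gamma> i)"
    and lmi: "neg_semidef (2 *\<^sub>R sym_part (transpose (G2 A Z B) ** P ** G1 \<tau>)
           + M1 \<Theta> + M2 \<tau> A Z B \<Omega> \<Gamma> + M3 \<tau> \<Omega> \<Gamma> + M4 \<Gamma> + M5 \<tau> C Cd Ch)"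
    and \<phi>: "\<phi> \<in> histories (max_delay \<tau>)" and u: "continuous_on {0..} u"
    and sol: "delay_solution \<tau> A Z B u \<phi> x" and t: "0 \<le> t0" "t0 \<le> t1"
  shows "storage \<tau> P \<Theta> \<Omega> \<Gamma> (segment (max_delay \<tau>) x t1)
      - storage \<tau> P \<Theta> \<Omega> \<Gamma> (segment (max_delay \<tau>) x t0)
    \<le> integral {t0..t1} (\<lambda>s. delay_output \<tau> C Cd Ch x s \<bullet> u s)"
proof -
  define r where "r = max_delay \<tau>"
  obtain g where cx: "continuous_on {- r..} x" and cg: "continuous_on {0..} g"
    and g [rule_format]: "\<forall>t\<ge>0. g t = A *v x t + (\<Sum>i\<in>UNIV. Z i *v x (t - \<tau> i)) + B *v u t"
    and dx0 [rule_format]: "\<forall>t\<ge>0. (x has_vector_derivative g t) (at t within {0..})"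
    and dx [rule_format]: "\<forall>t\<ge>- r. t \<noteq> 0 \<longrightarrow> (x has_vector_derivative g t) (at t within {- r..})"
    and int [rule_format]: "\<forall>(M :: real ^ 'n ^ 'n) b. (\<lambda>s. g s \<bullet> (M *v g s)) integrable_on {- r..b}"
    by (rule solution_derivative [OF pos mono \<phi> u sol, folded r_def])
  have le: "0 < \<tau> i" "\<tau> i \<le> r" for i
    using pos delay_le_max_delay [OF mono] by (auto simp: r_def)
  have r: "0 < r"
    using le less_le_trans by blast
  have quad: "continuous_on S (\<lambda>s. k s \<bullet> (M *v k s))" if "continuous_on S k"
    for S :: "real set" and k :: "real \<Rightarrow> real ^ 'n" and M
    by (intro continuous_intros that bounded_linear.continuous_on [OF matrix_vector_mul_bounded_linear])
  have dI: "((\<lambda>t. integral {t - \<tau> i..t} k) has_vector_derivative k t - k (t - \<tau> i)) (at t within {0..})"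
    if "continuous_on {- r..} k" "0 \<le> t" for k :: "real \<Rightarrow> 'b::banach" and i t
    by (rule sliding_integral_has_vector_derivative [OF _ _ that]) (use le [of i] in auto)
  define z where "z t = vjoin (x t) (stack (\<lambda>i. integral {t - \<tau> i..t} x))" for t
  define z' where "z' t = vjoin (g t) (stack (\<lambda>i. x t - x (t - \<tau> i)))" for t
  define V where "V t = storage \<tau> P \<Theta> \<Omega> \<Gamma> (segment r x t)" for t
  \<comment> \<open>The exact derivative of \<open>V\<close>; the window integrals in its last two
    sums are what the integral inequalities estimate.\<close>
  define V' where "V' t = 2 * (z t \<bullet> (P *v z' t))
      + (\<Sum>i\<in>UNIV. x t \<bullet> (\<Theta> i *v x t) - x (t - \<tau> i) \<bullet> (\<Theta> i *v x (t - \<tau> i)))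
      + (\<Sum>i\<in>UNIV. \<tau> i * (\<tau> i *\<^sub>R (x t \<bullet> (\<Omega> i *v x t)) - integral {t - \<tau> i..t} (\<lambda>s. x s \<bullet> (\<Omega> i *v x s))))
      + (\<Sum>i\<in>UNIV. \<tau> i * (\<tau> i *\<^sub>R (g t \<bullet> (\<Gamma> i *v g t)) - integral {t - \<tau> i..t} (\<lambda>s. g s \<bullet> (\<Gamma> i *v g s))))"
    for t
  have dV: "(V has_vector_derivative V' t) (at t within {0..})" if "0 \<le> t" for t
  proof -
    have dz: "(z has_vector_derivative z' t) (at t within {0..})"
      unfolding z_def z'_def by (intro vjoin_stack_has_vector_derivative dx0 dI cx that)
    have intx: "(\<lambda>s. x s \<bullet> (\<Omega> i *v x s)) integrable_on {- r..b}" for i b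
      by (intro integrable_continuous_real quad continuous_on_subset [OF cx]) auto
    have "((\<lambda>t. z t \<bullet> (P *v z t)
        + (\<Sum>i\<in>UNIV. integral {t - \<tau> i..t} (\<lambda>s. x s \<bullet> (\<Theta> i *v x s)))
        + (\<Sum>i\<in>UNIV. \<tau> i * integral {t - \<tau> i..t} (\<lambda>s. integral {s..t} (\<lambda>v. x v \<bullet> (\<Omega> i *v x v))))
        + (\<Sum>i\<in>UNIV. \<tau> i * integral {t - \<tau> i..t} (\<lambda>s. integral {s..t} (\<lambda>v. g v \<bullet> (\<Gamma> i *v g v)))))
      has_vector_derivative V' t) (at t within {0..})"
      unfolding V'_def
    proof (intro has_vector_derivative_add has_vector_derivative_sum
        bounded_linear.has_vector_derivative [OF bounded_linear_mult_right])
      show "((\<lambda>t. z t \<bullet> (P *v z t)) has_vector_derivative 2 * (z t \<bullet> (P *v z' t))) (at t within {0..})"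
        by (rule quadratic_form_has_vector_derivative [OF _ dz]) (use P in \<open>simp add: pos_semidef_def\<close>)
    next
      fix i
      show "((\<lambda>t. integral {t - \<tau> i..t} (\<lambda>s. x s \<bullet> (\<Theta> i *v x s))) has_vector_derivative
          x t \<bullet> (\<Theta> i *v x t) - x (t - \<tau> i) \<bullet> (\<Theta> i *v x (t - \<tau> i))) (at t within {0..})"
        by (rule dI [OF quad [OF cx] that])
      show "((\<lambda>t. integral {t - \<tau> i..t} (\<lambda>s. integral {s..t} (\<lambda>v. x v \<bullet> (\<Omega> i *v x v))))
          has_vector_derivative \<tau> i *\<^sub>R (x t \<bullet> (\<Omega> i *v x t))
            - integral {t - \<tau> i..t} (\<lambda>s. x s \<bullet> (\<Omega> i *v x s))) (at t within {0..})"
        by (rule sliding_double_integral_has_vector_derivative [OF _ _ intx _ that])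
          (use le [of i] r in \<open>auto intro!: quad continuous_on_subset [OF cx]\<close>)
      \<comment> \<open>Here \<open>g\<close> may jump at 0, so \<open>int\<close> supplies
        integrability on the history and \<open>cg\<close> continuity from 0 on.\<close>
      show "((\<lambda>t. integral {t - \<tau> i..t} (\<lambda>s. integral {s..t} (\<lambda>v. g v \<bullet> (\<Gamma> i *v g v))))
          has_vector_derivative \<tau> i *\<^sub>R (g t \<bullet> (\<Gamma> i *v g t))
            - integral {t - \<tau> i..t} (\<lambda>s. g s \<bullet> (\<Gamma> i *v g s))) (at t within {0..})"
        by (rule sliding_double_integral_has_vector_derivative [OF _ _ int _ that])
          (use le [of i] in \<open>auto intro!: quad cg\<close>)
    qed
    then show ?thesis
    proof (rule has_vector_derivative_transform [rotated 2])
      fix s :: real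
      assume "s \<in> {0..}"
      then show "V s = z s \<bullet> (P *v z s)
        + (\<Sum>i\<in>UNIV. integral {s - \<tau> i..s} (\<lambda>s. x s \<bullet> (\<Theta> i *v x s)))
        + (\<Sum>i\<in>UNIV. \<tau> i * integral {s - \<tau> i..s} (\<lambda>v. integral {v..s} (\<lambda>v. x v \<bullet> (\<Omega> i *v x v))))
        + (\<Sum>i\<in>UNIV. \<tau> i * integral {s - \<tau> i..s} (\<lambda>v. integral {v..s} (\<lambda>v. g v \<bullet> (\<Gamma> i *v g v))))"
        unfolding V_def z_def r_def by (intro storage_segment pos mono dx [unfolded r_def]) auto
    qed (use that in auto)
  qed
  have bound: "V' t \<le> delay_output \<tau> C Cd Ch x t \<bullet> u t" if "0 \<le> t" for t
  proof -
    define X where "X i = x (t - \<tau> i)" for i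
    \<comment> \<open>Scaled as a mean, because the third block column of \<open>G1\<close> and of
      the output row carries the factors \<open>\<tau> i\<close>.\<close>
    define Y where "Y i = (1 / \<tau> i) *\<^sub>R integral {t - \<tau> i..t} x" for i
    define e where "e i = x t + X i - 2 *\<^sub>R Y i" for i
    have Y: "\<tau> i *\<^sub>R Y i = integral {t - \<tau> i..t} x" for i
      using le(1) [of i] by (simp add: Y_def)
    have cxi: "continuous_on {t - \<tau> i..t} x" for i
      by (rule continuous_on_subset [OF cx]) (use le(2) [of i] that in auto)
    have 1: "\<tau> i * (\<tau> i *\<^sub>R (x t \<bullet> (\<Omega> i *v x t)) - integral {t - \<tau> i..t} (\<lambda>s. x s \<bullet> (\<Omega> i *v x s)))
        \<le> (\<tau> i)\<^sup>2 * (x t \<bullet> (\<Omega> i *v x t)) - (\<tau> i)\<^sup>2 * (Y i \<bullet> (\<Omega> i *v Y i))" for i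
    proof -
      have "(\<tau> i)\<^sup>2 * (Y i \<bullet> (\<Omega> i *v Y i)) = (\<tau> i *\<^sub>R Y i) \<bullet> (\<Omega> i *v (\<tau> i *\<^sub>R Y i))"
        by (simp add: matrix_vector_mult_scaleR power2_eq_square)
      also have "\<dots> \<le> (t - (t - \<tau> i)) * integral {t - \<tau> i..t} (\<lambda>s. x s \<bullet> (\<Omega> i *v x s))"
        unfolding Y by (rule jensen_quadratic [OF _ \<Omega> cxi]) (use le(1) [of i] in simp)
      finally show ?thesis
        by (simp add: right_diff_distrib power2_eq_square)
    qed
    have 2: "\<tau> i * (\<tau> i *\<^sub>R (g t \<bullet> (\<Gamma> i *v g t)) - integral {t - \<tau> i..t} (\<lambda>s. g s \<bullet> (\<Gamma> i *v g s)))
        \<le> (\<tau> i)\<^sup>2 * (g t \<bullet> (\<Gamma> i *v g t)) - (x t - X i) \<bullet> (\<Gamma> i *v (x t - X i))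
          - 3 * (e i \<bullet> (\<Gamma> i *v e i))" for i
    proof -
      have "(x t - X i) \<bullet> (\<Gamma> i *v (x t - X i)) + 3 * (e i \<bullet> (\<Gamma> i *v e i))
        \<le> (t - (t - \<tau> i)) * integral {t - \<tau> i..t} (\<lambda>s. g s \<bullet> (\<Gamma> i *v g s))"
      proof -
        have e: "e i = x t + x (t - \<tau> i) - (2 / (t - (t - \<tau> i))) *\<^sub>R integral {t - \<tau> i..t} x"
          by (simp add: e_def X_def Y_def)
        show ?thesis
          unfolding e X_def
        \<comment> \<open>For \<open>t < \<tau> i\<close> the window contains time 0 in its
          interior, hence the exceptional set \<open>{0}\<close>.\<close>
        proof (rule wirtinger_quadratic [OF _ \<Gamma> cxi, of _ "{0}"])
          fix s assume s: "s \<in> {t - \<tau> i<..<t} - {0}"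
          then have "- r < s"
            using le(2) [of i] that by auto
          moreover have "at s within {- r..} = at s"
            using \<open>- r < s\<close> by (intro at_within_interior) simp
          ultimately show "(x has_vector_derivative g s) (at s)"
            using dx [of s] s by simp
        next
          show "(\<lambda>s. g s \<bullet> (\<Gamma> i *v g s)) integrable_on {t - \<tau> i..t}"
            by (rule integrable_subinterval_real [OF int]) (use le(2) [of i] that in auto)
        qed (use le(1) [of i] in auto)
      qed
      then show ?thesis
        by (simp add: right_diff_distrib power2_eq_square)
    qed
    have "V' t \<le> 2 * (z t \<bullet> (P *v z' t))
      + (\<Sum>i\<in>UNIV. x t \<bullet> (\<Theta> i *v x t) - X i \<bullet> (\<Theta> i *v X i))
      + (\<Sum>i\<in>UNIV. (\<tau> i)\<^sup>2 * (x t \<bullet> (\<Omega> i *v x t)) - (\<tau> i)\<^sup>2 * (Y i \<bullet> (\<Omega> i *v Y i)))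
      + (\<Sum>i\<in>UNIV. (\<tau> i)\<^sup>2 * (g t \<bullet> (\<Gamma> i *v g t)) - (x t - X i) \<bullet> (\<Gamma> i *v (x t - X i))
          - 3 * (e i \<bullet> (\<Gamma> i *v e i)))"
      unfolding V'_def X_def [symmetric] by (intro add_mono sum_mono 1 2 order.refl)
    also have "\<dots> \<le> (C *v x t + (\<Sum>i\<in>UNIV. Cd i *v X i)
        + (\<Sum>i\<in>UNIV. \<tau> i *\<^sub>R (Ch i *v Y i))) \<bullet> u t"
    proof -
      have "g t = A *v x t + (\<Sum>i\<in>UNIV. Z i *v X i) + B *v u t"
        by (simp add: g that X_def)
      moreover have "z t = vjoin (x t) (stack (\<lambda>i. \<tau> i *\<^sub>R Y i))"
        by (simp add: z_def Y)
      ultimately show ?thesis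
        using lmi_dissipation [OF P \<Gamma> lmi, where x = "x t" and X = X and Y = Y and u = "u t"]
        by (simp add: z'_def X_def [symmetric] e_def)
    qed
    also have "\<dots> = delay_output \<tau> C Cd Ch x t \<bullet> u t"
      by (simp add: delay_output_def X_def flip: Y matrix_vector_mult_scaleR)
    finally show ?thesis .
  qed
  \<comment> \<open>The fundamental theorem yields integrability of \<open>V'\<close> together with
    the value, so the pointwise bound can be integrated directly.\<close>
  have "(V' has_integral V t1 - V t0) {t0..t1}"
    using t by (intro fundamental_theorem_of_calculus)
      (auto intro: has_vector_derivative_within_subset [OF dV])
  moreover have "(\<lambda>s. delay_output \<tau> C Cd Ch x s \<bullet> u s) integrable_on {t0..t1}"
  proof -
    have "continuous_on {0..} (\<lambda>t. integral {t - \<tau> i..t} x)" for i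
      unfolding continuous_on_eq_continuous_within
      by (intro ballI has_vector_derivative_continuous [OF dI [OF cx]]) simp
    moreover have "continuous_on {0..} (\<lambda>t. x (t - \<tau> i))" for i
      by (rule continuous_on_compose2 [OF cx]) (use le(2) [of i] in \<open>auto intro!: continuous_intros\<close>)
    moreover have "continuous_on {0..} x"
      by (rule continuous_on_subset [OF cx]) (use r in auto)
    ultimately have "continuous_on {0..} (\<lambda>s. delay_output \<tau> C Cd Ch x s \<bullet> u s)"
      unfolding delay_output_def
      by (intro continuous_intros u bounded_linear.continuous_on [OF matrix_vector_mul_bounded_linear])
    then show ?thesis
      using t by (intro integrable_continuous_real) (auto elim: continuous_on_subset)
  qed
  ultimately have "V t1 - V t0 \<le> integral {t0..t1} (\<lambda>s. delay_output \<tau> C Cd Ch x s \<bullet> u s)"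
    by (rule has_integral_le [OF _ integrable_integral]) (use bound t in auto)
  then show ?thesis
    by (simp add: V_def r_def)
qed

theorem theorem2p3:
  fixes \<tau> :: "'q::{finite,linorder} \<Rightarrow> real"
    and J R :: "real ^ 'n ^ 'n"
    and Z :: "'q \<Rightarrow> real ^ 'n ^ 'n"
    and B :: "real ^ 'm ^ 'n"
    and C :: "real ^ 'n ^ 'm"
    and Cd Ch :: "'q \<Rightarrow> real ^ 'n ^ 'm"
    and P :: "real ^ ('n + 'q \<times> 'n) ^ ('n + 'q \<times> 'n)"
    and \<Theta> \<Omega> \<Gamma> :: "'q \<Rightarrow> real ^ 'n ^ 'n"
  assumes "\<And>i. 0 < \<tau> i" and "mono \<tau>"
    and "J = - transpose J" and "pos_semidef R"
    and "pos_semidef P"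
    and "\<And>i. pos_semidef (\<Theta> i)" and "\<And>i. pos_semidef (\<Omega> i)" and "\<And>i. pos_semidef (\<Gamma> i)"
    and "neg_semidef (2 *\<^sub>R sym_part (transpose (G2 (J - R) Z B) ** P ** G1 \<tau>)
           + M1 \<Theta> + M2 \<tau> (J - R) Z B \<Omega> \<Gamma> + M3 \<tau> \<Omega> \<Gamma> + M4 \<Gamma> + M5 \<tau> C Cd Ch)"
  shows "passive_system (max_delay \<tau>) (delay_solution \<tau> (J - R) Z B) (delay_output \<tau> C Cd Ch) \<and>
         storage_function (max_delay \<tau>) (delay_solution \<tau> (J - R) Z B) (delay_output \<tau> C Cd Ch)
           (storage \<tau> P \<Theta> \<Omega> \<Gamma>)"
proof -
  have "storage_function (max_delay \<tau>) (delay_solution \<tau> (J - R) Z B) (delay_output \<tau> C Cd Ch)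
      (storage \<tau> P \<Theta> \<Omega> \<Gamma>)"
    unfolding storage_function_def
    by (intro conjI ballI allI impI storage_nonneg storage_zero storage_decrease) (rule assms | assumption)+
  then show ?thesis
    unfolding passive_system_def by blast
qed

end
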